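(* Let $S\ge-\omega$ be a densely defined symmetric operator, not essentially self-adjoint, on a real Hilbert space $\mathscr H$, with Friedrichs extension $A_\circ$, let $\tau:\mathscr H_\circ\to\mathfrak h$ be a continuous linear surjection onto a Hilbert space $\mathfrak h$ with $\mathscr D(S)=\mathrm{kernel}(\tau)$, let $\lambda_\circ>\omega$ and $G_\circ:=(\tau(A_\circ+\lambda_\circ)^{-1})^*:\mathfrak h\to\mathscr H$. Let $\varphi:\mathfrak h\to(-\infty,+\infty]$ be a proper convex function such that $\Theta:=\partial\varphi\subset\mathfrak h\times\mathfrak h$ is maximal monotone, and let $A_\Theta$ be the maximal monotone operator of type $\lambda_\circ$ $$\mathscr D(A_\Theta)=\{u=u_\circ+G_\circ\xi_u:\ u_\circ\in\mathscr D(A_\circ),\ (\xi_u,\tau u_\circ)\in\Theta\},\qquad A_\Theta(u)=A_\circ u_\circ-\lambda_\circ G_\circ\xi_u .$$ Suppose that $\mathrm{range}(G_\circ)\cap\mathscr D((A_\circ+\lambda_\circ)^{1/2})=\{0\}$ and define the proper convex function $\Phi:\mathscr H\to(-\infty,+\infty]$ by $$\Phi(u):=\begin{cases}\frac12\|(A_\circ+\lambda_\circ)^{1/2}u_\circ\|^2+\varphi(\xi), & u=u_\circ+G_\circ\xi\in\mathscr D(\Phi),\\ +\infty,&\text{otherwise,}\end{cases}$$ $$\mathscr D(\Phi):=\{u\in\mathscr H:\ u=u_\circ+G_\circ\xi,\ u_\circ\in\mathscr D((A_\circ+\lambda_\circ)^{1/2}),\ \xi\in\mathscr D(\varphi)\}.$$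 Then $A_\Theta+\lambda_\circ$ is a sub-potential maximal monotone operator, namely $$A_\Theta+\lambda_\circ=\partial\Phi$$ (equality of the graph of $A_\Theta+\lambda_\circ$ and the relation $\partial\Phi\subset\mathscr H\times\mathscr H$).
   Context: $\mathscr H$, $\mathfrak h$ are real Hilbert spaces with scalar products $\langle\cdot,\cdot\rangle$ and $[\cdot,\cdot]$. $\mathscr H_\circ$ is $\mathscr D(A_\circ)$ with scalar product $\langle A_\circ u,A_\circ v\rangle+\langle u,v\rangle$; $(A_\circ+\lambda_\circ)^{-1}$ is viewed as a bounded map $\mathscr H\to\mathscr H_\circ$, so $\tau(A_\circ+\lambda_\circ)^{-1}:\mathscr H\to\mathfrak h$ is bounded and $G_\circ$ is its adjoint. The decompositions $u=u_\circ+G_\circ\xi$ above are unique. A relation $\Theta\subset\mathfrak h\times\mathfrak h$ is monotone if $[\tilde\xi-\tilde\zeta,\xi-\zeta]\ge0$ for all $(\xi,\tilde\xi),(\zeta,\tilde\zeta)\in\Theta$, and maximal monotone if not properly contained in another monotone relation. A single-valued operator $A$ in $\mathscr H$ is maximal monotone of type $\lambda_\circ$ if $\langle A(u)-A(v),u-v\rangle\ge-\lambda_\circ\|u-v\|^2$ on $\mathscr D(A)$ and $\mathrm{range}(A+\lambda)=\mathscr H$ for some (equivalently any) $\lambda>\lambda_\circ$. Single-valued operators are identified with their graphs. For a proper (not identically $+\infty$) convex function $f:X\to(-\infty,+\infty]$ on a real Hilbert space $X$, $\mathscr D(f)=\{x:f(x)<+\infty\}$ and its sub-differential is $\partial f=\{(x,\tilde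 x)\in X\times X:\ \forall y\in X,\ f(x)\le f(y)+\langle\tilde x,x-y\rangle_X\}$. A sub-potential maximal monotone operator is one of the form $\partial f$, $f$ proper convex, which is a maximal monotone relation. *)

theory Defs
  imports "HOL-Analysis.Analysis"
begin

text \<open>
  A real Hilbert space is a type of sort \<open>{real_inner, complete_space}\<close>. Operators, linear or not,
  are identified with their graphs and are therefore sets of pairs; \<open>Domain A\<close> is the domain
  of the operator with graph \<open>A\<close>. Since the norm of \<open>'a \<times> 'a\<close> is
  \<open>norm (u, w) = sqrt ((norm u)\<^sup>2 + (norm w)\<^sup>2)\<close>, the graph of \<open>A\<close>, as a subspace of the product,
  is the domain of \<open>A\<close> with its graph scalar product.
\<close>

section \<open>Linear operators\<close>

definition linear_op :: "('a::real_vector \<times> 'a) set \<Rightarrow> bool" where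
  "linear_op T \<longleftrightarrow> subspace T \<and> single_valued T"

definition densely_defined :: "('a::real_inner \<times> 'a) set \<Rightarrow> bool" where
  "densely_defined T \<longleftrightarrow> closure (Domain T) = UNIV"

definition op_adjoint :: "('a::real_inner \<times> 'a) set \<Rightarrow> ('a \<times> 'a) set" where
  "op_adjoint T = {(u, w). \<forall>(v, z)\<in>T. z \<bullet> u = v \<bullet> w}"

definition symmetric_op :: "('a::real_inner \<times> 'a) set \<Rightarrow> bool" where
  "symmetric_op S \<longleftrightarrow> linear_op S \<and> (\<forall>(u, w)\<in>S. \<forall>(v, z)\<in>S. w \<bullet> v = u \<bullet> z)"

definition self_adjoint_op :: "('a::real_inner \<times> 'a) set \<Rightarrow> bool" where
  "self_adjoint_op A \<longleftrightarrow> linear_op A \<and> densely_defined A \<and> op_adjoint A = A"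

definition essentially_self_adjoint_op :: "('a::real_inner \<times> 'a) set \<Rightarrow> bool" where
  "essentially_self_adjoint_op S \<longleftrightarrow>
     symmetric_op S \<and> densely_defined S \<and> self_adjoint_op (closure S)"

definition op_bounded_below :: "('a::real_inner \<times> 'a) set \<Rightarrow> real \<Rightarrow> bool" where
  "op_bounded_below S c \<longleftrightarrow> (\<forall>(u, w)\<in>S. c * (norm u)\<^sup>2 \<le> w \<bullet> u)"

definition op_shift :: "('a::real_vector \<times> 'a) set \<Rightarrow> real \<Rightarrow> ('a \<times> 'a) set" where
  "op_shift T c = {(u, w + c *\<^sub>R u) | u w. (u, w) \<in> T}"

text \<open>The inverse, as a function on the whole space; meaningful for bijective operators.\<close>

definition op_inv :: "('a \<times> 'a) set \<Rightarrow> 'a \<Rightarrow> 'a" where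
  "op_inv T w = (THE u. (u, w) \<in> T)"

text \<open>The unique nonnegative self-adjoint square root; for graphs, \<open>B O B\<close> is the operator \<open>B\<^sup>2\<close>
  on its natural domain.\<close>

definition op_sqrt :: "('a::real_inner \<times> 'a) set \<Rightarrow> ('a \<times> 'a) set" where
  "op_sqrt T = (THE B. self_adjoint_op B \<and> op_bounded_below B 0 \<and> B O B = T)"

text \<open>
  The domain of the closure of the quadratic form \<open>u \<mapsto> S u \<bullet> u\<close> of a symmetric operator that is
  bounded from below: the limits in the ambient space of sequences in the domain of \<open>S\<close> that are
  Cauchy for the form. As these sequences converge, it does not matter whether a multiple of the
  ambient scalar product is added to the form, so none is.
\<close>

definition form_closure_domain :: "('a::real_inner \<times> 'a) set \<Rightarrow> 'a set" where
  "form_closure_domain S = {u. \<exists>v w. (\<forall>n::nat. (v n, w n) \<in> S) \<and> v \<longlonglongrightarrow> u \<and>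
     (\<forall>e>0. \<exists>N. \<forall>m\<ge>N. \<forall>n\<ge>N. \<bar>(w m - w n) \<bullet> (v m - v n)\<bar> < e)}"

text \<open>The Friedrichs extension is the restriction of the adjoint to the vectors of its domain that
  lie in the domain of the closed form.\<close>

definition friedrichs_ext :: "('a::real_inner \<times> 'a) set \<Rightarrow> ('a \<times> 'a) set" where
  "friedrichs_ext S = {(u, w). (u, w) \<in> op_adjoint S \<and> u \<in> form_closure_domain S}"

text \<open>\<open>\<tau>\<close> is a continuous linear surjection from the domain of \<open>A\<close>, with its graph scalar product.
  Its values outside this domain are irrelevant.\<close>

definition graph_surjection ::
    "('a::real_inner \<times> 'a) set \<Rightarrow> ('a \<Rightarrow> 'b::real_inner) \<Rightarrow> bool" where
  "graph_surjection A \<tau> \<longleftrightarrow>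
     (\<forall>u\<in>Domain A. \<forall>v\<in>Domain A. \<tau> (u + v) = \<tau> u + \<tau> v) \<and>
     (\<forall>c. \<forall>u\<in>Domain A. \<tau> (c *\<^sub>R u) = c *\<^sub>R \<tau> u) \<and>
     continuous_on A (\<lambda>p. \<tau> (fst p)) \<and>
     \<tau> ` Domain A = UNIV"

section \<open>Monotone relations and sub-differentials\<close>

definition monotone_rel :: "('a::real_inner \<times> 'a) set \<Rightarrow> bool" where
  "monotone_rel R \<longleftrightarrow> (\<forall>(x, x')\<in>R. \<forall>(y, y')\<in>R. 0 \<le> (x' - y') \<bullet> (x - y))"

definition maximal_monotone_rel :: "('a::real_inner \<times> 'a) set \<Rightarrow> bool" where
  "maximal_monotone_rel R \<longleftrightarrow>
     monotone_rel R \<and> \<not> (\<exists>R'. monotone_rel R' \<and> R \<subset> R')"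

definition maximal_monotone_op_of_type :: "real \<Rightarrow> ('a::real_inner \<times> 'a) set \<Rightarrow> bool" where
  "maximal_monotone_op_of_type c A \<longleftrightarrow> single_valued A \<and>
     (\<forall>(u, u')\<in>A. \<forall>(v, v')\<in>A. - c * (norm (u - v))\<^sup>2 \<le> (u' - v') \<bullet> (u - v)) \<and>
     (\<exists>l>c. Range (op_shift A l) = UNIV)"

text \<open>Convexity is only required for weights in the open unit interval, which is equivalent and
  avoids the product of \<open>0\<close> and \<open>\<infinity>\<close>.\<close>

definition proper_convex :: "('a::real_vector \<Rightarrow> ereal) \<Rightarrow> bool" where
  "proper_convex f \<longleftrightarrow>
     (\<forall>x. f x \<noteq> - \<infinity>) \<and> (\<exists>x. f x \<noteq> \<infinity>) \<and>
     (\<forall>x y s t. 0 < s \<longrightarrow> 0 < t \<longrightarrow> s + t = 1 \<longrightarrow>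
        f (s *\<^sub>R x + t *\<^sub>R y) \<le> ereal s * f x + ereal t * f y)"

definition eff_domain :: "('a \<Rightarrow> ereal) \<Rightarrow> 'a set" where
  "eff_domain f = {x. f x < \<infinity>}"

definition subdifferential :: "('a::real_inner \<Rightarrow> ereal) \<Rightarrow> ('a \<times> 'a) set" where
  "subdifferential f = {(x, x'). \<forall>y. f x \<le> f y + ereal (x' \<bullet> (x - y))}"

definition subpotential_maximal_monotone :: "('a::real_inner \<times> 'a) set \<Rightarrow> bool" where
  "subpotential_maximal_monotone R \<longleftrightarrow>
     (\<exists>f. proper_convex f \<and> R = subdifferential f) \<and> maximal_monotone_rel R"

section \<open>Nonlinear extensions\<close>

definition G_op :: "('a::real_inner \<times> 'a) set \<Rightarrow> ('a \<Rightarrow> 'b::real_inner) \<Rightarrow> real \<Rightarrow> 'b \<Rightarrow> 'a" where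
  "G_op A \<tau> l = adjoint (\<lambda>w. \<tau> (op_inv (op_shift A l) w))"

definition A_Theta :: "('a::real_inner \<times> 'a) set \<Rightarrow> ('a \<Rightarrow> 'b::real_inner) \<Rightarrow> real \<Rightarrow>
    ('b \<times> 'b) set \<Rightarrow> ('a \<times> 'a) set" where
  "A_Theta A \<tau> l \<Theta> =
     {(u + G_op A \<tau> l \<xi>, w - l *\<^sub>R G_op A \<tau> l \<xi>) | u w \<xi>. (u, w) \<in> A \<and> (\<xi>, \<tau> u) \<in> \<Theta>}"

text \<open>In the potential, \<open>b\<close> is the value at \<open>u\<^sub>0\<close> of the square root of \<open>A + l\<close>. The
  value of the description is unique when the decompositions \<open>u = u\<^sub>0 + G \<xi>\<close> are.\<close>

definition Phi_pot :: "('a::real_inner \<times> 'a) set \<Rightarrow> ('a \<Rightarrow> 'b::real_inner) \<Rightarrow> real \<Rightarrow>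
    ('b \<Rightarrow> ereal) \<Rightarrow> 'a \<Rightarrow> ereal" where
  "Phi_pot A \<tau> l \<phi> u =
     (if \<exists>u\<^sub>0 \<xi>. u\<^sub>0 \<in> Domain (op_sqrt (op_shift A l)) \<and> \<xi> \<in> eff_domain \<phi> \<and> u = u\<^sub>0 + G_op A \<tau> l \<xi>
      then THE r. \<exists>u\<^sub>0 b \<xi>. (u\<^sub>0, b) \<in> op_sqrt (op_shift A l) \<and> \<xi> \<in> eff_domain \<phi> \<and>
             u = u\<^sub>0 + G_op A \<tau> l \<xi> \<and> r = ereal ((norm b)\<^sup>2 / 2) + \<phi> \<xi>
      else \<infinity>)"

end

theory Submission
  imports Defs
begin

text \<open>
  Put \<open>L = A\<^sub>0 + l\<^sub>0\<close>, a bijective operator with bounded positive inverse \<open>R\<close>, and let \<open>Q\<close> be the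
  positive square root of \<open>R\<close>, so that the square root of \<open>L\<close> is the inverse of \<open>Q\<close>. With
  \<open>K = \<tau> R\<close> and \<open>G\<close> its adjoint, \<open>A_Theta + l\<^sub>0\<close> consists of the pairs \<open>(R w + G \<xi>, w)\<close> with
  \<open>(\<xi>, K w) \<in> \<partial>\<phi>\<close>. A direct computation shows that it is contained in the monotone relation
  \<open>\<partial>\<Phi>\<close>, so equality follows once it is maximal, that is, once \<open>A_Theta + l\<^sub>0 + 1\<close> is onto.
  This amounts to solving \<open>g \<in> (\<partial>\<phi> + C) \<xi>\<close>, where \<open>C = K (1 + R)\<^bsup>-1\<^esup> G\<close> is coercive because
  the adjoint of the surjection \<open>K\<close> is bounded below; a solution minimises a strongly convex
  functional.
\<close>

section \<open>Symmetric operators and their Friedrichs extensions\<close>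

text \<open>Passing to bounded maps removes domains from the computations, at a price.
  \<open>op_sqrt\<close> is a definite description among unbounded self-adjoint graphs, so it can be
  evaluated only after the root is shown to exist and to be unique there; both are brought back to
  bounded positive maps. The Friedrichs extension is given as a restriction of the adjoint, so its
  symmetry, lower bound and surjectivity have to be extracted from the form domain.

  Only one inclusion between \<open>A_Theta + l\<^sub>0\<close> and \<partial>\<Phi> is computed.
  The surjectivity that supplies the other is owed in any case: it also yields maximality and the
  range condition in the type \<open>l\<^sub>0\<close>. That the range of \<open>G\<close> meets the
  domain of the root only in \<open>0\<close> makes decompositions unique, hence \<Phi> well defined
  and \<open>A_Theta\<close> single valued.

  Existence is obtained twice by one method, for a quadratic form and for a strongly convex
  functional: the parallelogram law makes a minimising sequence Cauchy.\<close>

lemma quadratic_nonneg_imp_disc: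
  fixes a b c :: real
  assumes "\<And>t. 0 \<le> a + 2 * t * b + t\<^sup>2 * c"
  shows "b\<^sup>2 \<le> a * c"
proof -
  have a: "0 \<le> a" using assms[of 0] by simp
  show ?thesis
  proof (cases "c = 0")
    case True
    have "0 \<le> a + 2 * t * b" for t using assms[of t] True by simp
    from this[of "- (a + 1) / (2 * b)"] have "b = 0" by (cases "b = 0") (auto simp: field_simps)
    then show ?thesis using True by simp
  next
    case False
    have "0 \<le> c"
    proof (rule ccontr)
      assume "\<not> 0 \<le> c"
      \<comment> \<open>The quadratic is negative here: since \<open>t \<ge> 1\<close>,
        \<open>a + 2 * t * b\<close> is at most \<open>t * (a + 2 * \<bar>b\<bar>)\<close>, which is
        less than \<open>- (t\<^sup>2 * c)\<close>.\<close>
      define t where "t = 1 + (a + 2 * \<bar>b\<bar>) / - c"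
      have t1: "t \<ge> 1" using \<open>\<not> 0 \<le> c\<close> a by (simp add: t_def field_simps)
      have "- c * t = - c + (a + 2 * \<bar>b\<bar>)"
        using \<open>\<not> 0 \<le> c\<close> by (simp add: t_def field_simps)
      then have "- c * t > a + 2 * \<bar>b\<bar>" using \<open>\<not> 0 \<le> c\<close> by linarith
      then have "t * (- c * t) > t * (a + 2 * \<bar>b\<bar>)"
        using t1 by (intro mult_strict_left_mono) auto
      moreover have "t * a \<ge> a" using t1 a by (simp add: mult_le_cancel_right1)
      moreover have "2 * t * b \<le> 2 * t * \<bar>b\<bar>" using t1 by (simp add: mult_left_mono)
      moreover have "t * (- c * t) = - (t\<^sup>2 * c)" by (simp add: power2_eq_square)
      moreover have "t * (a + 2 * \<bar>b\<bar>) = t * a + 2 * t * \<bar>b\<bar>" by (simp add: distrib_left)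
      ultimately show False using assms[of t] by argo
    qed
    with False have c: "c > 0" by simp
    have "0 \<le> a + 2 * (- b / c) * b + (- b / c)\<^sup>2 * c" by (rule assms)
    also have "\<dots> = a - b\<^sup>2 / c" using c by (simp add: power2_eq_square field_simps)
    finally show ?thesis using c by (simp add: field_simps)
  qed
qed

lemma linear_opD:
  assumes "linear_op S"
  shows linear_op_add: "(u, w) \<in> S \<Longrightarrow> (v, z) \<in> S \<Longrightarrow> (u + v, w + z) \<in> S"
    and linear_op_diff: "(u, w) \<in> S \<Longrightarrow> (v, z) \<in> S \<Longrightarrow> (u - v, w - z) \<in> S"
    and linear_op_scale: "(u, w) \<in> S \<Longrightarrow> (c *\<^sub>R u, c *\<^sub>R w) \<in> S"
    and linear_op_zero: "(0, 0) \<in> S"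
  using assms subspace_add[of S "(u, w)" "(v, z)"] subspace_diff[of S "(u, w)" "(v, z)"]
    subspace_scale[of S "(u, w)" c] subspace_0[of S]
  by (auto simp: linear_op_def zero_prod_def)

text \<open>\<open>w \<bullet> v\<close> is a positive semidefinite scalar product on the domain;
  the quadratic in \<open>t\<close> is its value at \<open>u + t v\<close>, the cross terms agreeing
  by symmetry.\<close>

lemma symmetric_op_CauchySchwarz:
  assumes S: "symmetric_op S" "op_bounded_below S 0"
    and uw: "(u, w) \<in> S" and vz: "(v, z) \<in> S"
  shows "(w \<bullet> v)\<^sup>2 \<le> (w \<bullet> u) * (z \<bullet> v)"
proof (rule quadratic_nonneg_imp_disc)
  fix t
  have L: "linear_op S" using S by (simp add: symmetric_op_def)
  have "(u + t *\<^sub>R v, w + t *\<^sub>R z) \<in> S"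
    using L uw vz by (intro linear_op_add linear_op_scale)
  then have "0 \<le> (w + t *\<^sub>R z) \<bullet> (u + t *\<^sub>R v)"
    using S(2) by (force simp: op_bounded_below_def)
  moreover have "z \<bullet> u = w \<bullet> v"
    using S(1) uw vz by (force simp: symmetric_op_def inner_commute)
  ultimately show "0 \<le> w \<bullet> u + 2 * t * (w \<bullet> v) + t\<^sup>2 * (z \<bullet> v)"
    by (simp add: inner_add_left inner_add_right algebra_simps power2_eq_square)
qed

lemma op_bounded_below_mono:
  assumes "op_bounded_below S c" "d \<le> c"
  shows "op_bounded_below S d"
proof -
  have "d * (norm u)\<^sup>2 \<le> c * (norm u)\<^sup>2" for u :: 'a
    using assms(2) by (rule mult_right_mono) simp
  then show ?thesis using assms(1) unfolding op_bounded_below_def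
    by (blast intro: order_trans)
qed

text \<open>The solution is the limit of a minimising sequence of \<open>v \<mapsto> (S v \<bullet> v) / 2 - \<alpha> v\<close>;
  with \<open>S\<close> the identity this is the Riesz representation theorem.\<close>

lemma weak_solution:
  fixes S :: "('a::{real_inner, complete_space} \<times> 'a) set"
  assumes S: "symmetric_op S" "op_bounded_below S c" and c: "0 < c"
    and \<alpha>: "bounded_linear \<alpha>"
  obtains u where "u \<in> form_closure_domain S" "\<And>v z. (v, z) \<in> S \<Longrightarrow> z \<bullet> u = \<alpha> v"
proof -
  have L: "linear_op S" using S by (simp add: symmetric_op_def)
  interpret \<alpha>: bounded_linear \<alpha> by (rule \<alpha>)
  obtain K where K: "\<And>v. \<bar>\<alpha> v\<bar> \<le> norm v * K" using \<alpha>.bounded by auto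
  define J where "J = (\<lambda>p::'a\<times>'a. (snd p \<bullet> fst p) / 2 - \<alpha> (fst p))"
  \<comment> \<open>By completing the square, this is the minimum of
    \<open>c * s\<^sup>2 / 2 - K * s\<close> over real \<open>s\<close>, used at
    \<open>s = norm (fst p)\<close>.\<close>
  have lower: "- K\<^sup>2 / (2 * c) \<le> J p" if "p \<in> S" for p
  proof -
    have "c * (norm (fst p))\<^sup>2 \<le> snd p \<bullet> fst p"
      using that S(2) by (force simp: op_bounded_below_def)
    moreover have "\<alpha> (fst p) \<le> norm (fst p) * K" using K[of "fst p"] by simp
    moreover have "0 \<le> c / 2 * (norm (fst p) - K / c)\<^sup>2" using c by simp
    moreover have "c / 2 * (norm (fst p) - K / c)\<^sup>2
        = c * (norm (fst p))\<^sup>2 / 2 - norm (fst p) * K + K\<^sup>2 / (2 * c)"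
      using c by (simp add: power2_eq_square field_simps)
    ultimately show ?thesis unfolding J_def by linarith
  qed
  have bdd: "bdd_below (J ` S)" using lower by (intro bdd_belowI[of _ "- K\<^sup>2 / (2 * c)"]) auto
  have ne: "J ` S \<noteq> {}" using linear_op_zero[OF L] by auto
  define m where "m = Inf (J ` S)"
  have m: "m \<le> J p" if "p \<in> S" for p
    unfolding m_def using that bdd by (intro cInf_lower) auto
  define \<epsilon> :: "nat \<Rightarrow> real" where "\<epsilon> = (\<lambda>n. inverse (real (Suc n)))"
  have \<epsilon>0: "\<epsilon> \<longlonglongrightarrow> 0" unfolding \<epsilon>_def by (rule LIMSEQ_inverse_real_of_nat)
  have "\<exists>p\<in>S. J p < m + \<epsilon> n" for n
    using cInf_lessD[OF ne, of "m + \<epsilon> n"] by (auto simp: m_def \<epsilon>_def)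
  then obtain p where p: "\<And>n. p n \<in> S" "\<And>n. J (p n) < m + \<epsilon> n" by metis
  define v w where "v = (\<lambda>n. fst (p n))" and "w = (\<lambda>n. snd (p n))"
  have vw: "(v n, w n) \<in> S" for n using p(1)[of n] by (simp add: v_def w_def)
  have sym: "y \<bullet> v n = w n \<bullet> z" if "(z, y) \<in> S" for z y n
    using S(1) that vw[of n] by (force simp: symmetric_op_def inner_commute)
  \<comment> \<open>Parallelogram law: the linear part of \<open>J\<close> cancels, and the midpoint
    stays in the subspace \<open>S\<close>, where \<open>J\<close> is at least
    \<open>m\<close>.\<close>
  have energy: "(w i - w j) \<bullet> (v i - v j) \<le> 4 * (\<epsilon> i + \<epsilon> j)" for i j
  proof -
    have "m \<le> J ((1/2) *\<^sub>R (v i + v j), (1/2) *\<^sub>R (w i + w j))"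
      by (intro m linear_op_scale[OF L] linear_op_add[OF L] vw)
    moreover have "J (v i, w i) < m + \<epsilon> i" "J (v j, w j) < m + \<epsilon> j"
      using p(2) by (simp_all add: v_def w_def)
    moreover have "(w i - w j) \<bullet> (v i - v j)
        = 4 * (J (v i, w i) + J (v j, w j) - 2 * J ((1/2) *\<^sub>R (v i + v j), (1/2) *\<^sub>R (w i + w j)))"
      by (simp add: J_def \<alpha>.add \<alpha>.scaleR inner_add_left inner_add_right inner_diff_left
          inner_diff_right field_simps)
    ultimately show ?thesis by argo
  qed
  have below: "c * (norm (v i - v j))\<^sup>2 \<le> (w i - w j) \<bullet> (v i - v j)" for i j
    using S(2) linear_op_diff[OF L vw vw] by (force simp: op_bounded_below_def)
  have small: "\<exists>N. \<forall>i\<ge>N. \<forall>j\<ge>N. 4 * (\<epsilon> i + \<epsilon> j) < e" if "e > 0" for e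
  proof -
    have "eventually (\<lambda>n. \<epsilon> n < e / 8) sequentially"
      using order_tendstoD(2)[OF \<epsilon>0, of "e / 8"] that by simp
    then obtain N where N: "\<And>n. n \<ge> N \<Longrightarrow> \<epsilon> n < e / 8" by (auto simp: eventually_sequentially)
    then have "4 * (\<epsilon> i + \<epsilon> j) < e" if "i \<ge> N" "j \<ge> N" for i j
      using N[OF that(1)] N[OF that(2)] by argo
    then show ?thesis by blast
  qed
  have "Cauchy v"
  proof (rule metric_CauchyI)
    fix e :: real assume "e > 0"
    then obtain N where N: "\<And>i j. i \<ge> N \<Longrightarrow> j \<ge> N \<Longrightarrow> 4 * (\<epsilon> i + \<epsilon> j) < c * e\<^sup>2"
      using small[of "c * e\<^sup>2"] c by auto
    have "dist (v i) (v j) < e" if "i \<ge> N" "j \<ge> N" for i j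
    proof -
      have "c * (norm (v i - v j))\<^sup>2 < c * e\<^sup>2"
        using N[OF that] below[of i j] energy[of i j] by linarith
      then have "(norm (v i - v j))\<^sup>2 < e\<^sup>2" using c by simp
      then show ?thesis using \<open>e > 0\<close> unfolding dist_norm by (rule power2_less_imp_less[OF _ less_imp_le])
    qed
    then show "\<exists>N. \<forall>i\<ge>N. \<forall>j\<ge>N. dist (v i) (v j) < e" by blast
  qed
  then obtain u where u: "v \<longlonglongrightarrow> u" using Cauchy_convergent by (auto simp: convergent_def)
  have "\<bar>(w i - w j) \<bullet> (v i - v j)\<bar> \<le> 4 * (\<epsilon> i + \<epsilon> j)" for i j
  proof -
    have "0 \<le> c * (norm (v i - v j))\<^sup>2" using c by simp
    then show ?thesis using energy[of i j] below[of i j] by linarith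
  qed
  then have "\<exists>N. \<forall>i\<ge>N. \<forall>j\<ge>N. \<bar>(w i - w j) \<bullet> (v i - v j)\<bar> < e" if "e > 0" for e
    using small[OF that] by (meson le_less_trans)
  then have "u \<in> form_closure_domain S"
    unfolding form_closure_domain_def using vw u
    by (intro CollectI exI[of _ v] exI[of _ w]) auto
  moreover have "y \<bullet> u = \<alpha> z" if zy: "(z, y) \<in> S" for z y
  proof -
    \<comment> \<open>\<open>u\<close> need not lie in \<open>Domain S\<close>, so stationarity is
      tested at \<open>v n\<close>: \<open>d n\<close> is the derivative of \<open>J\<close> there
      along \<open>z\<close>, and near-minimality makes the second-order expansion in
      \<open>t\<close> nonnegative up to the error \<open>\<epsilon> n\<close>.\<close>
    define d where "d = (\<lambda>n. w n \<bullet> z - \<alpha> z)"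
    have "(d n / 2)\<^sup>2 \<le> \<epsilon> n * ((y \<bullet> z) / 2)" for n
    proof (rule quadratic_nonneg_imp_disc)
      fix t
      have "m \<le> J (v n + t *\<^sub>R z, w n + t *\<^sub>R y)"
        by (intro m linear_op_scale[OF L] linear_op_add[OF L] vw zy)
      moreover have "J (v n, w n) < m + \<epsilon> n" using p(2) by (simp add: v_def w_def)
      ultimately show "0 \<le> \<epsilon> n + 2 * t * (d n / 2) + t\<^sup>2 * ((y \<bullet> z) / 2)"
        using sym[OF zy, of n]
        by (simp add: J_def d_def \<alpha>.add \<alpha>.scaleR inner_add_left inner_add_right
            power2_eq_square field_simps)
    qed
    moreover have "(\<lambda>n. \<epsilon> n * ((y \<bullet> z) / 2)) \<longlonglongrightarrow> 0 * ((y \<bullet> z) / 2)"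
      by (intro tendsto_mult \<epsilon>0 tendsto_const)
    ultimately have "(\<lambda>n. (d n / 2)\<^sup>2) \<longlonglongrightarrow> 0"
      by (intro tendsto_sandwich[of "\<lambda>_. 0" "\<lambda>n. (d n / 2)\<^sup>2" sequentially "\<lambda>n. \<epsilon> n * ((y \<bullet> z) / 2)"])
        auto
    then have "(\<lambda>n. sqrt ((d n / 2)\<^sup>2)) \<longlonglongrightarrow> sqrt 0" by (rule tendsto_real_sqrt)
    then have "(\<lambda>n. d n / 2) \<longlonglongrightarrow> 0" by (simp add: tendsto_rabs_zero_iff)
    then have "(\<lambda>n. 2 * (d n / 2) + \<alpha> z) \<longlonglongrightarrow> 2 * 0 + \<alpha> z" by (intro tendsto_intros)
    then have "(\<lambda>n. w n \<bullet> z) \<longlonglongrightarrow> \<alpha> z" by (simp add: d_def diff_divide_distrib)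
    moreover have "(\<lambda>n. w n \<bullet> z) \<longlonglongrightarrow> y \<bullet> u"
      unfolding sym[OF zy, symmetric] by (intro tendsto_intros u)
    ultimately show ?thesis using LIMSEQ_unique by blast
  qed
  ultimately show ?thesis using that by blast
qed

section \<open>Bounded symmetric maps, Riesz representation and bounded adjoints\<close>

lemma symmetric_op_graph:
  assumes "bounded_linear T" "\<And>x y. T x \<bullet> y = x \<bullet> T y"
  shows "symmetric_op {(x, T x) | x. True}"
proof -
  interpret T: bounded_linear T by (rule assms)
  show ?thesis
    using assms(2)
    by (auto simp: symmetric_op_def linear_op_def single_valued_def subspace_def zero_prod_def
        T.zero T.add T.scaleR inner_commute)
qed

lemma riesz_representation:
  fixes \<alpha> :: "'a::{real_inner, complete_space} \<Rightarrow> real"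
  assumes "bounded_linear \<alpha>"
  obtains u where "\<And>v. \<alpha> v = v \<bullet> u"
proof -
  have sym: "symmetric_op {(x, x) | x::'a. True}"
    using symmetric_op_graph[OF bounded_linear_ident] by simp
  have bb: "op_bounded_below {(x, x) | x::'a. True} 1"
    by (auto simp: op_bounded_below_def power2_norm_eq_inner)
  obtain u where "\<And>v z. (v, z) \<in> {(x, x) | x::'a. True} \<Longrightarrow> z \<bullet> u = \<alpha> v"
    by (rule weak_solution[OF sym bb zero_less_one assms]) (rule that)
  then show ?thesis using that[of u] by force
qed

text \<open>\<open>adjoint\<close> is a choice, so a map with the adjoint relation must first be
  exhibited; Riesz provides it pointwise. The norm bound comes from
  \<open>(norm (adjoint K x))\<^sup>2 = K (adjoint K x) \<bullet> x\<close>.\<close>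

lemma adjoint_bounded_linear:
  fixes K :: "'a::{real_inner, complete_space} \<Rightarrow> 'b::real_inner"
  assumes "bounded_linear K"
  shows "K x \<bullet> y = x \<bullet> adjoint K y" and "bounded_linear (adjoint K)"
proof -
  have "\<exists>u. \<forall>v. K v \<bullet> y = v \<bullet> u" for y
    using riesz_representation[of "\<lambda>v. K v \<bullet> y"]
      bounded_linear_compose[OF bounded_linear_inner_left assms] by metis
  then have "\<exists>G. \<forall>x y. K x \<bullet> y = x \<bullet> G y" by metis
  then have adj: "K x \<bullet> y = x \<bullet> adjoint K y" for x y
    unfolding adjoint_def using someI_ex[of "\<lambda>G. \<forall>x y. K x \<bullet> y = x \<bullet> G y"] by blast
  then show "K x \<bullet> y = x \<bullet> adjoint K y" .
  obtain B where B: "\<And>x. norm (K x) \<le> norm x * B" "B \<ge> 0"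
    using bounded_linear.nonneg_bounded[OF assms] by blast
  show "bounded_linear (adjoint K)"
  proof (rule bounded_linear_intro)
    have eqI: "u = v" if "\<And>z. z \<bullet> u = z \<bullet> v" for u v :: 'a
      using that vector_eq_ldot by blast
    show "adjoint K (x + y) = adjoint K x + adjoint K y" for x y
      by (rule eqI) (simp add: inner_add_right flip: adj)
    show "adjoint K (r *\<^sub>R x) = r *\<^sub>R adjoint K x" for r x
      by (rule eqI) (simp flip: adj)
    show "norm (adjoint K x) \<le> norm x * B" for x
    proof -
      have "norm (adjoint K x) * norm (adjoint K x) = K (adjoint K x) \<bullet> x"
        by (simp add: adj power2_norm_eq_inner flip: power2_eq_square)
      also have "\<dots> \<le> norm (adjoint K x) * B * norm x"
        by (meson B(1) norm_cauchy_schwarz norm_ge_zero mult_right_mono order_trans)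
      finally show ?thesis
        using B(2) by (cases "adjoint K x = 0") (auto simp: mult.assoc mult.commute)
    qed
  qed
qed

section \<open>Shifts by multiples of the identity\<close>

lemma op_shift_iff: "(u, w) \<in> op_shift T c \<longleftrightarrow> (u, w - c *\<^sub>R u) \<in> T"
  by (force simp: op_shift_def)

lemma op_shift_shift_uminus: "op_shift (op_shift T c) (- c) = T"
  by (auto simp: op_shift_iff)

lemma Domain_op_shift: "Domain (op_shift T c) = Domain T"
  by (force simp: op_shift_def)

lemma linear_op_shift:
  assumes "linear_op T"
  shows "linear_op (op_shift T c)"
proof -
  have "subspace (op_shift T c)"
  proof (rule subspaceI)
    show "0 \<in> op_shift T c"
      using linear_op_zero[OF assms] by (simp add: op_shift_iff zero_prod_def)
  next
    fix p q assume "p \<in> op_shift T c" "q \<in> op_shift T c"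
    then show "p + q \<in> op_shift T c"
      using linear_op_add[OF assms, of "fst p" "snd p - c *\<^sub>R fst p" "fst q" "snd q - c *\<^sub>R fst q"]
      by (cases p; cases q) (simp add: op_shift_iff algebra_simps)
  next
    fix r p assume "p \<in> op_shift T c"
    then show "r *\<^sub>R p \<in> op_shift T c"
      using linear_op_scale[OF assms, of "fst p" "snd p - c *\<^sub>R fst p" r]
      by (cases p) (simp add: op_shift_iff algebra_simps)
  qed
  moreover have "single_valued (op_shift T c)"
    using assms by (fastforce simp: linear_op_def single_valued_def op_shift_iff)
  ultimately show ?thesis by (simp add: linear_op_def)
qed

lemma symmetric_op_shift:
  assumes "symmetric_op T"
  shows "symmetric_op (op_shift T c)"
  using assms linear_op_shift
  by (fastforce simp: symmetric_op_def op_shift_def inner_add_left inner_add_right)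

lemma op_bounded_below_shift:
  assumes "op_bounded_below T d"
  shows "op_bounded_below (op_shift T c) (d + c)"
  using assms
  by (fastforce simp: op_bounded_below_def op_shift_def inner_add_left power2_norm_eq_inner
      distrib_right)

lemma op_adjoint_shift: "op_adjoint (op_shift T c) = op_shift (op_adjoint T) c"
proof -
  have "(u, w) \<in> op_adjoint (op_shift T c) \<longleftrightarrow> (u, w) \<in> op_shift (op_adjoint T) c" for u w
  proof -
    have "(u, w) \<in> op_adjoint (op_shift T c)
        \<longleftrightarrow> (\<forall>v z. (v, z) \<in> T \<longrightarrow> (z + c *\<^sub>R v) \<bullet> u = v \<bullet> w)"
      by (force simp: op_adjoint_def op_shift_def)
    also have "\<dots> \<longleftrightarrow> (\<forall>v z. (v, z) \<in> T \<longrightarrow> z \<bullet> u = v \<bullet> (w - c *\<^sub>R u))"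
      by (simp add: inner_add_left inner_diff_right algebra_simps)
    also have "\<dots> \<longleftrightarrow> (u, w) \<in> op_shift (op_adjoint T) c"
      by (force simp: op_adjoint_def op_shift_iff)
    finally show ?thesis .
  qed
  then show ?thesis by auto
qed

text \<open>The approximating sequences converge in norm, so the extra term
  \<open>c * (norm (v m - v n))\<^sup>2\<close> tends to zero. One inclusion for arbitrary shifts
  suffices: shifting back gives the other.\<close>

lemma form_closure_domain_shift: "form_closure_domain (op_shift T c) = form_closure_domain T"
proof -
  have sub: "form_closure_domain T \<subseteq> form_closure_domain (op_shift T c)" for T :: "('a \<times> 'a) set" and c
  proof
    fix u assume "u \<in> form_closure_domain T"
    then obtain v w where vw: "\<And>n::nat. (v n, w n) \<in> T" "v \<longlonglongrightarrow> u"
      and C: "\<And>e. e > 0 \<Longrightarrow> \<exists>N. \<forall>m\<ge>N. \<forall>n\<ge>N. \<bar>(w m - w n) \<bullet> (v m - v n)\<bar> < e"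
      unfolding form_closure_domain_def by auto
    define z where "z = (\<lambda>n. w n + c *\<^sub>R v n)"
    have "(v n, z n) \<in> op_shift T c" for n using vw by (simp add: op_shift_iff z_def)
    moreover have "\<exists>N. \<forall>m\<ge>N. \<forall>n\<ge>N. \<bar>(z m - z n) \<bullet> (v m - v n)\<bar> < e" if "e > 0" for e
    proof -
      obtain N1 where N1: "\<And>m n. m \<ge> N1 \<Longrightarrow> n \<ge> N1 \<Longrightarrow> \<bar>(w m - w n) \<bullet> (v m - v n)\<bar> < e / 2"
        using C[of "e / 2"] \<open>e > 0\<close> by auto
      \<comment> \<open>Makes the extra term at most \<open>e / 2\<close>; adding \<open>1\<close>
        keeps the divisor positive for \<open>c = 0\<close>.\<close>
      define d where "d = sqrt (e / 2 / (\<bar>c\<bar> + 1))"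
      have d: "d > 0" "d\<^sup>2 = e / 2 / (\<bar>c\<bar> + 1)" using \<open>e > 0\<close> by (auto simp: d_def)
      obtain N2 where N2: "\<And>m n. m \<ge> N2 \<Longrightarrow> n \<ge> N2 \<Longrightarrow> norm (v m - v n) < d"
        using LIMSEQ_imp_Cauchy[OF vw(2)] d(1) unfolding Cauchy_def dist_norm by meson
      have "\<bar>(z m - z n) \<bullet> (v m - v n)\<bar> < e" if "m \<ge> max N1 N2" "n \<ge> max N1 N2" for m n
      proof -
        have "(norm (v m - v n))\<^sup>2 \<le> d\<^sup>2"
          using N2[of m n] that by (intro power_mono) auto
        then have "\<bar>c\<bar> * (norm (v m - v n))\<^sup>2 \<le> (\<bar>c\<bar> + 1) * d\<^sup>2"
          by (intro mult_mono) auto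
        also have "\<dots> = e / 2"
            unfolding d(2) by (subst times_divide_eq_right, rule nonzero_mult_div_cancel_left) auto
        finally have "\<bar>c * (norm (v m - v n))\<^sup>2\<bar> \<le> e / 2" by (simp add: abs_mult)
        moreover have "(z m - z n) \<bullet> (v m - v n)
            = (w m - w n) \<bullet> (v m - v n) + c * (norm (v m - v n))\<^sup>2"
          by (simp add: z_def power2_norm_eq_inner inner_add_left inner_diff_left algebra_simps)
        moreover have "\<bar>(w m - w n) \<bullet> (v m - v n)\<bar> < e / 2" using N1 that by simp
        ultimately show ?thesis by argo
      qed
      then show ?thesis by blast
    qed
    ultimately show "u \<in> form_closure_domain (op_shift T c)"
      using vw(2) unfolding form_closure_domain_def by blast
  qed
  show ?thesis
    using sub[of T c] sub[of "op_shift T c" "- c"] by (simp add: op_shift_shift_uminus)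
qed

text \<open>Lets a possibly negative lower bound of \<open>S\<close> be traded for the positive one
  of its shift, which weak solvability requires.\<close>

lemma friedrichs_ext_shift: "friedrichs_ext (op_shift S c) = op_shift (friedrichs_ext S) c"
  by (auto simp: friedrichs_ext_def op_adjoint_shift form_closure_domain_shift op_shift_iff)

section \<open>The closed form and the Friedrichs extension\<close>

lemma form_closure_domain_subspace:
  assumes S: "symmetric_op S" "op_bounded_below S 0"
  shows "subspace (form_closure_domain S)"
proof -
  have L: "linear_op S" using S by (simp add: symmetric_op_def)
  have pos: "0 \<le> w \<bullet> v" if "(v, w) \<in> S" for v w
    using S(2) that by (force simp: op_bounded_below_def)
  show ?thesis
  proof (rule subspaceI)
    show "0 \<in> form_closure_domain S"
      unfolding form_closure_domain_def
      using linear_op_zero[OF L] by (intro CollectI exI[of _ "\<lambda>_. 0"]) auto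
  next
    fix x y assume "x \<in> form_closure_domain S" "y \<in> form_closure_domain S"
    then obtain v w v' w' where vw: "\<And>n::nat. (v n, w n) \<in> S" "v \<longlonglongrightarrow> x"
        "\<And>n::nat. (v' n, w' n) \<in> S" "v' \<longlonglongrightarrow> y"
      and C: "\<And>e. e > 0 \<Longrightarrow> \<exists>N. \<forall>m\<ge>N. \<forall>n\<ge>N. \<bar>(w m - w n) \<bullet> (v m - v n)\<bar> < e"
        "\<And>e. e > 0 \<Longrightarrow> \<exists>N. \<forall>m\<ge>N. \<forall>n\<ge>N. \<bar>(w' m - w' n) \<bullet> (v' m - v' n)\<bar> < e"
      unfolding form_closure_domain_def by auto
    have "\<exists>N. \<forall>m\<ge>N. \<forall>n\<ge>N.
        \<bar>((w m + w' m) - (w n + w' n)) \<bullet> ((v m + v' m) - (v n + v' n))\<bar> < e" if "e > 0" for e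
    proof -
      obtain N1 where N1: "\<And>m n. m \<ge> N1 \<Longrightarrow> n \<ge> N1 \<Longrightarrow> \<bar>(w m - w n) \<bullet> (v m - v n)\<bar> < e / 4"
        using C(1)[of "e / 4"] \<open>e > 0\<close> by auto
      obtain N2 where N2: "\<And>m n. m \<ge> N2 \<Longrightarrow> n \<ge> N2 \<Longrightarrow> \<bar>(w' m - w' n) \<bullet> (v' m - v' n)\<bar> < e / 4"
        using C(2)[of "e / 4"] \<open>e > 0\<close> by auto
      have "\<bar>((w m + w' m) - (w n + w' n)) \<bullet> ((v m + v' m) - (v n + v' n))\<bar> < e"
        if "m \<ge> max N1 N2" "n \<ge> max N1 N2" for m n
      proof -
        define a b a' b' where "a = v m - v n" and "b = w m - w n"
          and "a' = v' m - v' n" and "b' = w' m - w' n"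
        have ab: "(a, b) \<in> S" "(a', b') \<in> S"
          unfolding a_def b_def a'_def b'_def by (intro linear_op_diff[OF L] vw)+
        \<comment> \<open>Parallelogram law for the form: dropping the nonnegative value at the
          difference leaves less than \<open>2 * (e / 4) + 2 * (e / 4)\<close>.\<close>
        have "0 \<le> (b + b') \<bullet> (a + a')" "0 \<le> (b - b') \<bullet> (a - a')"
          using pos[OF linear_op_add[OF L ab]] pos[OF linear_op_diff[OF L ab]] .
        moreover have "(b + b') \<bullet> (a + a') + (b - b') \<bullet> (a - a') = 2 * (b \<bullet> a) + 2 * (b' \<bullet> a')"
          by (simp add: inner_add_left inner_add_right inner_diff_left inner_diff_right)
        moreover have "b \<bullet> a < e / 4" "b' \<bullet> a' < e / 4"
          using N1[of m n] N2[of m n] that by (auto simp: a_def b_def a'_def b'_def)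
        moreover have "((w m + w' m) - (w n + w' n)) \<bullet> ((v m + v' m) - (v n + v' n))
            = (b + b') \<bullet> (a + a')"
          by (simp add: a_def b_def a'_def b'_def algebra_simps)
        ultimately show ?thesis by argo
      qed
      then show ?thesis by blast
    qed
    moreover have "(v n + v' n, w n + w' n) \<in> S" for n by (intro linear_op_add[OF L] vw)
    moreover have "(\<lambda>n. v n + v' n) \<longlonglongrightarrow> x + y" by (intro tendsto_intros vw)
    ultimately show "x + y \<in> form_closure_domain S"
      unfolding form_closure_domain_def
      by (intro CollectI exI[of _ "\<lambda>n. v n + v' n"] exI[of _ "\<lambda>n. w n + w' n"]) auto
  next
    fix r x assume "x \<in> form_closure_domain S"
    then obtain v w where vw: "\<And>n::nat. (v n, w n) \<in> S" "v \<longlonglongrightarrow> x"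
      and C: "\<And>e. e > 0 \<Longrightarrow> \<exists>N. \<forall>m\<ge>N. \<forall>n\<ge>N. \<bar>(w m - w n) \<bullet> (v m - v n)\<bar> < e"
      unfolding form_closure_domain_def by auto
    have "\<exists>N. \<forall>m\<ge>N. \<forall>n\<ge>N. \<bar>(r *\<^sub>R w m - r *\<^sub>R w n) \<bullet> (r *\<^sub>R v m - r *\<^sub>R v n)\<bar> < e"
      if "e > 0" for e
    proof -
      have pos: "0 < e / (r\<^sup>2 + 1)" using that by (simp add: add_nonneg_pos)
      obtain N where N: "\<And>m n. m \<ge> N \<Longrightarrow> n \<ge> N \<Longrightarrow>
          \<bar>(w m - w n) \<bullet> (v m - v n)\<bar> < e / (r\<^sup>2 + 1)"
        using C[OF pos] by auto
      have "\<bar>(r *\<^sub>R w m - r *\<^sub>R w n) \<bullet> (r *\<^sub>R v m - r *\<^sub>R v n)\<bar> < e" if "m \<ge> N" "n \<ge> N" for m n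
      proof -
        have "\<bar>(r *\<^sub>R w m - r *\<^sub>R w n) \<bullet> (r *\<^sub>R v m - r *\<^sub>R v n)\<bar>
            = r\<^sup>2 * \<bar>(w m - w n) \<bullet> (v m - v n)\<bar>"
          by (simp add: abs_mult power2_eq_square flip: scaleR_diff_right)
        also have "\<dots> \<le> r\<^sup>2 * (e / (r\<^sup>2 + 1))"
          using N[OF that] by (intro mult_left_mono) auto
        also have "\<dots> < (r\<^sup>2 + 1) * (e / (r\<^sup>2 + 1))"
          using pos by (intro mult_strict_right_mono) auto
        also have "\<dots> = e" by (simp add: add_nonneg_eq_0_iff)
        finally show ?thesis .
      qed
      then show ?thesis by blast
    qed
    moreover have "(r *\<^sub>R v n, r *\<^sub>R w n) \<in> S" for n by (intro linear_op_scale[OF L] vw)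
    moreover have "(\<lambda>n. r *\<^sub>R v n) \<longlonglongrightarrow> r *\<^sub>R x" by (intro tendsto_intros vw)
    ultimately show "r *\<^sub>R x \<in> form_closure_domain S"
      unfolding form_closure_domain_def
      by (intro CollectI exI[of _ "\<lambda>n. r *\<^sub>R v n"] exI[of _ "\<lambda>n. r *\<^sub>R w n"]) auto
  qed
qed

lemma op_adjoint_subspace: "subspace (op_adjoint S)"
  by (rule subspaceI)
    (simp_all add: op_adjoint_def zero_prod_def inner_add_right split_beta)

lemma single_valued_op_adjoint:
  assumes "densely_defined S"
  shows "single_valued (op_adjoint S)"
proof (rule single_valuedI)
  fix x y z assume "(x, y) \<in> op_adjoint S" "(x, z) \<in> op_adjoint S"
  then have eq: "v \<bullet> y = v \<bullet> z" if "v \<in> Domain S" for v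
    using that by (force simp: op_adjoint_def)
  have "closed {v. v \<bullet> y = v \<bullet> z}" by (intro closed_Collect_eq continuous_intros)
  then have "closure (Domain S) \<subseteq> {v. v \<bullet> y = v \<bullet> z}"
    using eq by (intro closure_minimal) auto
  then show "y = z" using assms by (auto simp: densely_defined_def intro: vector_eq_ldot[THEN iffD1])
qed

text \<open>The closed form at \<open>u\<close> and \<open>u'\<close> is represented by
  \<open>w\<close>. For fixed \<open>n\<close>, symmetry and the adjoint relation give \<open>z m
  \<bullet> v' n \<longlonglongrightarrow> w \<bullet> v' n\<close>; Cauchy-Schwarz in the form
  makes this uniform in large \<open>n\<close>, because the energies of \<open>v'\<close> stay
  bounded.\<close>

lemma friedrichs_form_limit:
  assumes S: "symmetric_op S" "op_bounded_below S 0"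
    and uw: "(u, w) \<in> op_adjoint S"
    and v: "\<And>n::nat. (v n, z n) \<in> S" "v \<longlonglongrightarrow> u"
    and Cv: "\<And>e. e > 0 \<Longrightarrow> \<exists>N. \<forall>m\<ge>N. \<forall>n\<ge>N. \<bar>(z m - z n) \<bullet> (v m - v n)\<bar> < e"
    and v': "\<And>n::nat. (v' n, z' n) \<in> S" "v' \<longlonglongrightarrow> u'"
    and Cv': "\<And>e. e > 0 \<Longrightarrow> \<exists>N. \<forall>m\<ge>N. \<forall>n\<ge>N. \<bar>(z' m - z' n) \<bullet> (v' m - v' n)\<bar> < e"
  shows "(\<lambda>n. z n \<bullet> v' n) \<longlonglongrightarrow> w \<bullet> u'"
proof -
  have L: "linear_op S" using S by (simp add: symmetric_op_def)
  have pos: "0 \<le> w \<bullet> v" if "(v, w) \<in> S" for v w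
    using S(2) that by (force simp: op_bounded_below_def)
  obtain N0 where N0: "\<And>m n. m \<ge> N0 \<Longrightarrow> n \<ge> N0 \<Longrightarrow> \<bar>(z' m - z' n) \<bullet> (v' m - v' n)\<bar> < 1"
    using Cv'[of 1] by auto
  \<comment> \<open>Energy bound by the parallelogram law: twice the energy at \<open>N0\<close>
    plus twice that of the increment, which is below \<open>1\<close>.\<close>
  define Q where "Q = 2 * (z' N0 \<bullet> v' N0) + 2"
  have Q: "z' n \<bullet> v' n \<le> Q" if "n \<ge> N0" for n
  proof -
    define a b where "a = v' n - v' N0" and "b = z' n - z' N0"
    have "(a - v' N0, b - z' N0) \<in> S"
      unfolding a_def b_def by (intro linear_op_diff[OF L] v')
    then have "0 \<le> (b - z' N0) \<bullet> (a - v' N0)" by (rule pos)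
    moreover have "z' n \<bullet> v' n + (b - z' N0) \<bullet> (a - v' N0) = 2 * (b \<bullet> a) + 2 * (z' N0 \<bullet> v' N0)"
      by (simp add: a_def b_def inner_diff_left inner_diff_right algebra_simps)
    moreover have "b \<bullet> a < 1" using N0[of n N0] that by (simp add: a_def b_def)
    ultimately show ?thesis unfolding Q_def by argo
  qed
  have Q0: "Q > 0" unfolding Q_def using pos[OF v'(1)[of N0]] by simp
  have lim: "(\<lambda>m. z m \<bullet> v' n) \<longlonglongrightarrow> w \<bullet> v' n" for n
  proof -
    have "z m \<bullet> v' n = z' n \<bullet> v m" for m
      using S(1) v(1)[of m] v'(1)[of n] by (force simp: symmetric_op_def inner_commute)
    moreover have "w \<bullet> v' n = z' n \<bullet> u"
      using uw v'(1)[of n] by (force simp: op_adjoint_def inner_commute)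
    ultimately show ?thesis by (simp add: tendsto_inner v(2))
  qed
  have "(\<lambda>n. z n \<bullet> v' n - w \<bullet> v' n) \<longlonglongrightarrow> 0"
  proof (rule LIMSEQ_I)
    fix e :: real assume "e > 0"
    then have "(e / 2)\<^sup>2 / Q > 0" using Q0 by simp
    then obtain N where N: "\<And>m n. m \<ge> N \<Longrightarrow> n \<ge> N \<Longrightarrow> \<bar>(z m - z n) \<bullet> (v m - v n)\<bar> < (e / 2)\<^sup>2 / Q"
      using Cv by meson
    have "norm (z n \<bullet> v' n - w \<bullet> v' n - 0) < e" if n: "n \<ge> max N N0" for n
    proof -
      have "\<bar>z n \<bullet> v' n - z m \<bullet> v' n\<bar> \<le> e / 2" if "m \<ge> N" for m
      proof -
        have "((z n - z m) \<bullet> v' n)\<^sup>2 \<le> ((z n - z m) \<bullet> (v n - v m)) * (z' n \<bullet> v' n)"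
          by (intro symmetric_op_CauchySchwarz[OF S] linear_op_diff[OF L] v v')
        also have "\<dots> \<le> ((e / 2)\<^sup>2 / Q) * Q"
          using N[of n m] that n Q[of n] pos[OF v'(1)[of n]] Q0 by (intro mult_mono) auto
        also have "\<dots> = (e / 2)\<^sup>2" using Q0 by simp
        finally have "\<bar>(z n - z m) \<bullet> v' n\<bar> \<le> e / 2"
          using \<open>e > 0\<close> abs_le_square_iff[of "(z n - z m) \<bullet> v' n" "e / 2"] by simp
        then show ?thesis by (simp add: inner_diff_left)
      qed
      moreover have "(\<lambda>m. \<bar>z n \<bullet> v' n - z m \<bullet> v' n\<bar>) \<longlonglongrightarrow> \<bar>z n \<bullet> v' n - w \<bullet> v' n\<bar>"
        by (intro tendsto_intros lim)
      ultimately have "\<bar>z n \<bullet> v' n - w \<bullet> v' n\<bar> \<le> e / 2"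
        by (intro LIMSEQ_le_const2[of _ _ "e / 2"]) auto
      then show ?thesis using \<open>e > 0\<close> by simp
    qed
    then show "\<exists>N. \<forall>n\<ge>N. norm (z n \<bullet> v' n - w \<bullet> v' n - 0) < e" by blast
  qed
  moreover have "(\<lambda>n. w \<bullet> v' n) \<longlonglongrightarrow> w \<bullet> u'" by (intro tendsto_intros v')
  ultimately have "(\<lambda>n. (z n \<bullet> v' n - w \<bullet> v' n) + w \<bullet> v' n) \<longlonglongrightarrow> 0 + w \<bullet> u'"
    by (rule tendsto_add)
  then show ?thesis by simp
qed

text \<open>The equal form values \<open>z n \<bullet> v' n\<close> and
  \<open>z' n \<bullet> v n\<close> converge to \<open>w \<bullet> u'\<close> and to
  \<open>w' \<bullet> u\<close>. Density of the domain is what makes the extension single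
  valued.\<close>

lemma symmetric_op_friedrichs_ext:
  assumes S: "symmetric_op S" "op_bounded_below S 0" "densely_defined S"
  shows "symmetric_op (friedrichs_ext S)"
proof -
  have "subspace (friedrichs_ext S)"
  proof -
    have "friedrichs_ext S = op_adjoint S \<inter> fst -` form_closure_domain S"
      by (auto simp: friedrichs_ext_def)
    then show ?thesis
      using op_adjoint_subspace[of S] form_closure_domain_subspace[OF S(1,2)]
      by (simp add: subspace_inter linear_subspace_vimage bounded_linear.linear[OF bounded_linear_fst])
  qed
  moreover have "single_valued (friedrichs_ext S)"
    using single_valued_op_adjoint[OF S(3)] by (auto simp: friedrichs_ext_def single_valued_def)
  moreover have "w \<bullet> u' = u \<bullet> w'"
    if uw: "(u, w) \<in> friedrichs_ext S" and uw': "(u', w') \<in> friedrichs_ext S" for u w u' w'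
  proof -
    have adj: "(u, w) \<in> op_adjoint S" "(u', w') \<in> op_adjoint S"
      using uw uw' by (auto simp: friedrichs_ext_def)
    obtain v z where v: "\<And>n::nat. (v n, z n) \<in> S" "v \<longlonglongrightarrow> u"
        "\<And>e. e > 0 \<Longrightarrow> \<exists>N. \<forall>m\<ge>N. \<forall>n\<ge>N. \<bar>(z m - z n) \<bullet> (v m - v n)\<bar> < e"
      using uw unfolding friedrichs_ext_def form_closure_domain_def by auto
    obtain v' z' where v': "\<And>n::nat. (v' n, z' n) \<in> S" "v' \<longlonglongrightarrow> u'"
        "\<And>e. e > 0 \<Longrightarrow> \<exists>N. \<forall>m\<ge>N. \<forall>n\<ge>N. \<bar>(z' m - z' n) \<bullet> (v' m - v' n)\<bar> < e"
      using uw' unfolding friedrichs_ext_def form_closure_domain_def by auto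
    have "z n \<bullet> v' n = z' n \<bullet> v n" for n
      using S(1) v(1)[of n] v'(1)[of n] by (force simp: symmetric_op_def inner_commute)
    then show ?thesis
      using friedrichs_form_limit[OF S(1,2) adj(1) v v'] friedrichs_form_limit[OF S(1,2) adj(2) v' v]
      by (simp add: LIMSEQ_unique inner_commute)
  qed
  ultimately show ?thesis by (auto simp: symmetric_op_def linear_op_def)
qed

text \<open>Taking both sequences of the form limit equal shows that the energies converge to
  \<open>w \<bullet> u\<close>, and the bound passes to the limit.\<close>

lemma op_bounded_below_friedrichs_ext:
  assumes S: "symmetric_op S" "op_bounded_below S c" and c: "0 \<le> c"
  shows "op_bounded_below (friedrichs_ext S) c"
  unfolding op_bounded_below_def
proof safe
  fix u w assume uw: "(u, w) \<in> friedrichs_ext S"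
  then have adj: "(u, w) \<in> op_adjoint S" by (auto simp: friedrichs_ext_def)
  obtain v z where v: "\<And>n::nat. (v n, z n) \<in> S" "v \<longlonglongrightarrow> u"
      "\<And>e. e > 0 \<Longrightarrow> \<exists>N. \<forall>m\<ge>N. \<forall>n\<ge>N. \<bar>(z m - z n) \<bullet> (v m - v n)\<bar> < e"
    using uw unfolding friedrichs_ext_def form_closure_domain_def by auto
  have "(\<lambda>n. z n \<bullet> v n) \<longlonglongrightarrow> w \<bullet> u"
    by (rule friedrichs_form_limit[OF S(1) op_bounded_below_mono[OF S(2) c] adj v v])
  moreover have "(\<lambda>n. c * (norm (v n))\<^sup>2) \<longlonglongrightarrow> c * (norm u)\<^sup>2"
    by (intro tendsto_intros v(2))
  moreover have "c * (norm (v n))\<^sup>2 \<le> z n \<bullet> v n" for n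
    using S(2) v(1)[of n] by (force simp: op_bounded_below_def)
  ultimately show "c * (norm u)\<^sup>2 \<le> w \<bullet> u" by (intro LIMSEQ_le) auto
qed

text \<open>A weak solution for the functional \<open>v \<mapsto> v \<bullet> f\<close> is a pair
  \<open>(u, f)\<close> of the adjoint, and it comes with membership in the form domain.\<close>

lemma Range_friedrichs_ext:
  fixes S :: "('a::{real_inner, complete_space} \<times> 'a) set"
  assumes "symmetric_op S" "op_bounded_below S c" "0 < c"
  shows "Range (friedrichs_ext S) = UNIV"
proof -
  have "f \<in> Range (friedrichs_ext S)" for f
  proof -
    obtain u where "u \<in> form_closure_domain S" "\<And>v z. (v, z) \<in> S \<Longrightarrow> z \<bullet> u = v \<bullet> f"
      using weak_solution[OF assms bounded_linear_inner_left] by blast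
    then show ?thesis by (auto simp: friedrichs_ext_def op_adjoint_def)
  qed
  then show ?thesis by auto
qed

section \<open>Square roots of positive operators\<close>

definition psd :: "('a::real_inner \<Rightarrow> 'a) \<Rightarrow> bool" where
  "psd T \<longleftrightarrow> bounded_linear T \<and> (\<forall>x y. T x \<bullet> y = x \<bullet> T y) \<and> (\<forall>x. 0 \<le> T x \<bullet> x)"

lemma psdD:
  assumes "psd T"
  shows "bounded_linear T" "T x \<bullet> y = x \<bullet> T y" "0 \<le> T x \<bullet> x"
  using assms by (auto simp: psd_def)

text \<open>The lower bound makes preimages unique and bounds \<open>R\<close> by
  \<open>1 / c\<close>; injectivity of \<open>R\<close> is the single-valuedness of
  \<open>T\<close>.\<close>

lemma symmetric_op_inverse:
  assumes T: "symmetric_op T" "op_bounded_below T c" "0 < c" "Range T = UNIV"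
  obtains R where "psd R" "inj R" "T = {(R w, w) | w. True}"
proof -
  have L: "linear_op T" using T by (simp add: symmetric_op_def)
  have inj: "u = v" if "(u, w) \<in> T" "(v, w) \<in> T" for u v w
  proof -
    have "c * (norm (u - v))\<^sup>2 \<le> (w - w) \<bullet> (u - v)"
      using linear_op_diff[OF L that] T(2) by (force simp: op_bounded_below_def)
    then show ?thesis using \<open>0 < c\<close> by (simp add: mult_le_0_iff)
  qed
  have "\<exists>u. (u, w) \<in> T" for w using T(4) by blast
  then obtain R where R: "\<And>w. (R w, w) \<in> T" by metis
  have "(u, w) \<in> T \<longleftrightarrow> u = R w" for u w using R inj by blast
  then have T_eq: "T = {(R w, w) | w. True}" by auto
  have below: "c * (norm (R x))\<^sup>2 \<le> x \<bullet> R x" for x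
    using R[of x] T(2) by (force simp: op_bounded_below_def)
  have "bounded_linear R"
  proof (rule bounded_linear_intro)
    show "R (x + y) = R x + R y" for x y by (intro inj[OF R] linear_op_add[OF L] R)
    show "R (r *\<^sub>R x) = r *\<^sub>R R x" for r x by (intro inj[OF R] linear_op_scale[OF L] R)
    show "norm (R x) \<le> norm x * (1 / c)" for x
    proof -
      have "c * norm (R x) * norm (R x) \<le> norm x * norm (R x)"
        using below[of x] norm_cauchy_schwarz[of x "R x"] by (simp add: power2_eq_square mult.assoc)
      then show ?thesis using \<open>0 < c\<close>
        by (cases "R x = 0") (auto simp: field_simps)
    qed
  qed
  moreover have "R x \<bullet> y = x \<bullet> R y" for x y
    using T(1) R[of x] R[of y] by (force simp: symmetric_op_def)
  moreover have "0 \<le> R x \<bullet> x" for x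
  proof -
    have "0 \<le> c * (norm (R x))\<^sup>2" using \<open>0 < c\<close> by simp
    then show ?thesis using below[of x] by (simp add: inner_commute)
  qed
  ultimately have "psd R" by (simp add: psd_def)
  moreover have "inj R"
  proof (rule injI)
    fix x y assume "R x = R y"
    then have "(R x, x) \<in> T" "(R x, y) \<in> T" using R[of x] R[of y] by auto
    then show "x = y" using L by (auto simp: linear_op_def single_valued_def)
  qed
  ultimately show ?thesis using that T_eq by blast
qed

lemma psd_CauchySchwarz:
  assumes "psd T"
  shows "(T x \<bullet> y)\<^sup>2 \<le> (T x \<bullet> x) * (T y \<bullet> y)"
  using symmetric_op_CauchySchwarz[OF symmetric_op_graph[of T], of x "T x" y "T y"]
    psdD[OF assms] by (auto simp: op_bounded_below_def)

lemma psd_zeroI: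
  assumes "psd T" "T x \<bullet> x = 0"
  shows "T x = 0"
  using psd_CauchySchwarz[OF assms(1), of x "T x"] assms(2) by simp

lemma psd_square:
  assumes "psd T"
  shows "psd (\<lambda>x. T (T x))"
  unfolding psd_def
proof (intro conjI allI)
  show "bounded_linear (\<lambda>x. T (T x))"
    by (rule bounded_linear_compose[OF psdD(1)[OF assms] psdD(1)[OF assms]])
  show "T (T x) \<bullet> y = x \<bullet> T (T y)" for x y by (simp only: psdD(2)[OF assms])
  show "0 \<le> T (T x) \<bullet> x" for x using psdD(2)[OF assms, of "T x" x] by simp
qed

text \<open>The increments are \<open>(1 - y n)\<^sup>2 / 2\<close> and \<open>1\<close> is the
  fixed point. A bounded monotone sequence is Cauchy, which makes it usable as a majorant for
  operators.\<close>

lemma sqrt_iteration_scalar: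
  fixes y :: "nat \<Rightarrow> real"
  assumes "y 0 = 0" "\<And>n. y (Suc n) = (1 + (y n)\<^sup>2) / 2"
  shows "0 \<le> y n" "y n \<le> 1" "y n \<le> y (Suc n)"
proof -
  have "0 \<le> y n \<and> y n \<le> 1"
  proof (induction n)
    case (Suc n)
    then have "(y n)\<^sup>2 \<le> 1\<^sup>2" by (intro power_mono) auto
    then show ?case by (simp add: assms)
  qed (simp add: assms)
  moreover have "y (Suc n) - y n = (1 - y n)\<^sup>2 / 2"
    by (simp add: assms power2_eq_square field_simps)
  moreover have "0 \<le> (1 - y n)\<^sup>2 / 2" by simp
  ultimately show "0 \<le> y n" "y n \<le> 1" "y n \<le> y (Suc n)" by argo+
qed

text \<open>The root of \<open>1 - T\<close> is \<open>1 - Y\<close> for the limit \<open>Y\<close> of the iteration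
  \<open>Y \<mapsto> (T + Y\<^sup>2) / 2\<close> from \<open>0\<close>. Its increments are dominated in norm by those of the same
  iteration for the number \<open>1\<close>.\<close>

lemma psd_sqrt_contraction:
  fixes T :: "'a::{real_inner, complete_space} \<Rightarrow> 'a"
  assumes T: "psd T" and T1: "\<And>x. norm (T x) \<le> norm x"
  obtains Q where "psd Q" "\<And>x. Q (Q x) = x - T x"
    "\<And>P x. bounded_linear P \<Longrightarrow> (\<And>x. P (T x) = T (P x)) \<Longrightarrow> P (Q x) = Q (P x)"
proof -
  define Y :: "nat \<Rightarrow> 'a \<Rightarrow> 'a" where "Y = rec_nat (\<lambda>_. 0) (\<lambda>_ f x. (1/2) *\<^sub>R (T x + f (f x)))"
  have Y0 [simp]: "Y 0 x = 0" and YS: "Y (Suc n) x = (1/2) *\<^sub>R (T x + Y n (Y n x))" for n x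
    by (simp_all add: Y_def)
  define y :: "nat \<Rightarrow> real" where "y = rec_nat 0 (\<lambda>_ t. (1 + t\<^sup>2) / 2)"
  have y0: "y 0 = 0" and yS: "y (Suc n) = (1 + (y n)\<^sup>2) / 2" for n by (simp_all add: y_def)
  note y = sqrt_iteration_scalar[of y, OF y0 yS]
  interpret T: bounded_linear T using psdD(1)[OF T] .
  have lin: "linear (Y n)" for n
  proof (induction n)
    case 0 show ?case by (rule linearI) auto
  next
    case (Suc n)
    then show ?case
      by (intro linearI) (simp_all add: YS T.add T.scaleR linear_add linear_scale algebra_simps)
  qed
  have nY: "norm (Y n x) \<le> y n * norm x" for n x
  proof (induction n arbitrary: x)
    case 0 show ?case by (simp add: y0)
  next
    case (Suc n)
    have "norm (Y n (Y n x)) \<le> y n * (y n * norm x)"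
      by (rule order_trans[OF Suc mult_left_mono[OF Suc y(1)]])
    then have "norm (T x + Y n (Y n x)) \<le> norm x + y n * (y n * norm x)"
      using T1[of x] norm_triangle_ineq[of "T x" "Y n (Y n x)"] by linarith
    moreover have "norm (Y (Suc n) x) = norm (T x + Y n (Y n x)) / 2"
      unfolding YS norm_scaleR by simp
    ultimately show ?case by (simp add: yS power2_eq_square field_simps)
  qed
  have nY1: "norm (Y n x) \<le> norm x" for n x
    using order_trans[OF nY[of n x] mult_right_mono[OF y(2)[of n] norm_ge_zero[of x]]] by simp
  have d: "norm (Y (Suc n) x - Y n x) \<le> (y (Suc n) - y n) * norm x" for n x
  proof (induction n arbitrary: x)
    case 0 show ?case using T1[of x] by (simp add: YS y0 yS)
  next
    case (Suc n)
    \<comment> \<open>The difference of squares is split so that no factors have to be commuted; the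
      scalar bounds then add up to half of
      \<open>(y (Suc n))\<^sup>2 - (y n)\<^sup>2\<close>.\<close>
    have "Y (Suc (Suc n)) x - Y (Suc n) x
        = (1/2) *\<^sub>R (Y (Suc n) (Y (Suc n) x - Y n x) + (Y (Suc n) (Y n x) - Y n (Y n x)))"
      by (simp add: YS[of "Suc n"] YS[of n x] linear_diff[OF lin] flip: scaleR_diff_right)
    also have "norm \<dots> \<le> (1/2) * (norm (Y (Suc n) (Y (Suc n) x - Y n x))
        + norm (Y (Suc n) (Y n x) - Y n (Y n x)))"
      by (simp add: norm_triangle_ineq)
    also have "\<dots> \<le> (1/2) * (y (Suc n) * ((y (Suc n) - y n) * norm x)
        + (y (Suc n) - y n) * (y n * norm x))"
      using order_trans[OF nY[of "Suc n"] mult_left_mono[OF Suc y(1)[of "Suc n"]], of x]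
        order_trans[OF Suc[of "Y n x"] mult_left_mono[OF nY[of n x], of "y (Suc n) - y n"]] y(3)[of n]
      by (intro mult_left_mono add_mono) auto
    also have "\<dots> = (y (Suc (Suc n)) - y (Suc n)) * norm x"
      by (simp add: yS[of "Suc n"] yS[of n] power2_eq_square field_simps)
    finally show ?case .
  qed
  have dmn: "norm (Y (n + k) x - Y n x) \<le> (y (n + k) - y n) * norm x" for n k x
  proof (induction k)
    case (Suc k)
    have "norm (Y (n + Suc k) x - Y n x)
        \<le> norm (Y (Suc (n + k)) x - Y (n + k) x) + norm (Y (n + k) x - Y n x)"
      using norm_triangle_ineq[of "Y (Suc (n + k)) x - Y (n + k) x" "Y (n + k) x - Y n x"] by simp
    also have "\<dots> \<le> (y (Suc (n + k)) - y (n + k)) * norm x + (y (n + k) - y n) * norm x"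
      by (intro add_mono d Suc)
    finally show ?case by (simp add: algebra_simps)
  qed simp
  have "Bseq y" using y(1,2) by (intro BseqI'[of _ 1]) simp
  then have "Cauchy y"
    using y(3) by (intro convergent_Cauchy Bseq_monoseq_convergent) (auto simp: monoseq_Suc)
  have "Cauchy (\<lambda>n. Y n x)" for x
  proof (rule metric_CauchyI)
    fix e :: real assume "e > 0"
    then have "e / (norm x + 1) > 0" by (simp add: add_nonneg_pos)
    then obtain N where N: "\<And>m n. m \<ge> N \<Longrightarrow> n \<ge> N \<Longrightarrow> \<bar>y m - y n\<bar> < e / (norm x + 1)"
      using \<open>Cauchy y\<close> unfolding Cauchy_def dist_real_def by meson
    have less: "norm (Y m x - Y n x) < e" if "n \<ge> N" "m \<ge> n" for m n
    proof -
      have "norm (Y m x - Y n x) \<le> (y m - y n) * norm x"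
        using dmn[of n "m - n" x] that by simp
      also have "\<dots> \<le> (e / (norm x + 1)) * norm x"
        using N[of m n] that by (intro mult_right_mono) auto
      also have "\<dots> < (e / (norm x + 1)) * (norm x + 1)"
        using \<open>e / (norm x + 1) > 0\<close> by (intro mult_strict_left_mono) auto
      also have "\<dots> = e" using norm_ge_zero[of x] by (simp add: add_nonneg_eq_0_iff)
      finally show ?thesis .
    qed
    have "dist (Y m x) (Y n x) < e" if "m \<ge> N" "n \<ge> N" for m n
      using less[of n m] less[of m n] that by (cases "n \<le> m") (auto simp: dist_norm norm_minus_commute)
    then show "\<exists>N. \<forall>m\<ge>N. \<forall>n\<ge>N. dist (Y m x) (Y n x) < e" by blast
  qed
  then have "\<exists>l. (\<lambda>n. Y n x) \<longlonglongrightarrow> l" for x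
    using Cauchy_convergent by (auto simp: convergent_def)
  then obtain Z where Z: "\<And>x. (\<lambda>n. Y n x) \<longlonglongrightarrow> Z x" by metis
  have nZ: "norm (Z x) \<le> norm x" for x
    by (rule LIMSEQ_le_const2[OF tendsto_norm[OF Z]]) (auto simp: nY1)
  have Zadd: "Z (u + v) = Z u + Z v" for u v
    using LIMSEQ_unique[OF Z[of "u + v"]] tendsto_add[OF Z[of u] Z[of v]]
    by (simp add: linear_add[OF lin])
  have Zscale: "Z (r *\<^sub>R v) = r *\<^sub>R Z v" for r v
    using LIMSEQ_unique[OF Z[of "r *\<^sub>R v"]] tendsto_scaleR[OF tendsto_const[of r] Z[of v]]
    by (simp add: linear_scale[OF lin])
  have Zlin: "bounded_linear Z"
    by (rule bounded_linear_intro[of _ 1]) (simp_all add: Zadd Zscale nZ)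
  have symY: "Y n u \<bullet> v = u \<bullet> Y n v" for n u v
    by (induction n arbitrary: u v) (simp_all add: YS inner_add_left inner_add_right psdD(2)[OF T])
  have symZ: "Z u \<bullet> v = u \<bullet> Z v" for u v
    using LIMSEQ_unique[OF tendsto_inner[OF Z[of u] tendsto_const[of v]]]
      tendsto_inner[OF tendsto_const[of u] Z[of v]] by (simp add: symY)
  have ZZ: "Z x = (1/2) *\<^sub>R (T x + Z (Z x))" for x
  proof -
    \<comment> \<open>Pointwise convergence alone does not pass through the composition; the uniform
      bound \<open>norm (Y n x) \<le> norm x\<close> does it.\<close>
    have "(\<lambda>n. Y n (Y n x - Z x)) \<longlonglongrightarrow> 0"
    proof (rule tendsto_norm_zero_cancel,
        rule tendsto_sandwich[of "\<lambda>_. 0" _ _ "\<lambda>n. norm (Y n x - Z x)"])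
      show "(\<lambda>n. norm (Y n x - Z x)) \<longlonglongrightarrow> 0"
        using tendsto_norm_zero[OF LIM_zero[OF Z]] .
    qed (auto simp: nY1)
    from tendsto_add[OF this Z[of "Z x"]] have "(\<lambda>n. Y n (Y n x)) \<longlonglongrightarrow> Z (Z x)"
      by (simp add: linear_diff[OF lin])
    then have "(\<lambda>n. Y (Suc n) x) \<longlonglongrightarrow> (1/2) *\<^sub>R (T x + Z (Z x))"
      unfolding YS by (intro tendsto_intros)
    moreover have "(\<lambda>n. Y (Suc n) x) \<longlonglongrightarrow> Z x" by (rule LIMSEQ_Suc[OF Z])
    ultimately show ?thesis by (rule LIMSEQ_unique[symmetric])
  qed
  define Q where "Q = (\<lambda>x. x - Z x)"
  have "psd Q"
    unfolding psd_def
  proof (intro conjI allI)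
    show "bounded_linear Q" unfolding Q_def by (intro bounded_linear_sub bounded_linear_ident Zlin)
    show "Q u \<bullet> v = u \<bullet> Q v" for u v by (simp add: Q_def inner_diff_left inner_diff_right symZ)
    show "0 \<le> Q u \<bullet> u" for u
    proof -
      have "Z u \<bullet> u \<le> norm u * norm u"
        using norm_cauchy_schwarz[of "Z u" u] mult_right_mono[OF nZ[of u] norm_ge_zero[of u]] by simp
      then show ?thesis by (simp add: Q_def inner_diff_left power2_norm_eq_inner flip: power2_eq_square)
    qed
  qed
  moreover have "Q (Q x) = x - T x" for x
  proof -
    have "2 *\<^sub>R Z x = T x + Z (Z x)"
      using arg_cong[OF ZZ[of x], of "scaleR 2"] by simp
    then have "T x = Z x + Z x - Z (Z x)" by (simp add: scaleR_2 algebra_simps)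
    then show ?thesis by (simp add: Q_def linear_diff[OF bounded_linear.linear[OF Zlin]])
  qed
  moreover have "P (Q x) = Q (P x)" if P: "bounded_linear P" "\<And>x. P (T x) = T (P x)" for P x
  proof -
    interpret P: bounded_linear P by (rule P(1))
    have "P (Y n x) = Y n (P x)" for n x
      by (induction n arbitrary: x) (simp_all add: YS P.zero P.scaleR P.add P(2))
    then have "P (Z x) = Z (P x)"
      using LIMSEQ_unique[OF P.tendsto[OF Z[of x]]] Z[of "P x"] by simp
    then show ?thesis by (simp add: Q_def P.diff)
  qed
  ultimately show ?thesis using that by blast
qed

text \<open>With \<open>k\<close> a bound of \<open>R\<close>, the map \<open>1 - R / k\<close> is a
  positive contraction, so the iteration applies, and the root is rescaled by \<open>sqrt k\<close>.
  The commutation clause is carried along for the uniqueness proof.\<close>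

lemma psd_sqrt_commuting:
  fixes R :: "'a::{real_inner, complete_space} \<Rightarrow> 'a"
  assumes R: "psd R"
  obtains Q where "psd Q" "\<And>x. Q (Q x) = R x"
    "\<And>P x. bounded_linear P \<Longrightarrow> (\<And>x. P (R x) = R (P x)) \<Longrightarrow> P (Q x) = Q (P x)"
proof -
  interpret R: bounded_linear R using psdD(1)[OF R] .
  obtain k where k: "0 < k" "\<And>x. norm (R x) \<le> norm x * k" using R.pos_bounded by blast
  define T where "T = (\<lambda>x. x - (1 / k) *\<^sub>R R x)"
  have "psd T"
    unfolding psd_def
  proof (intro conjI allI)
    show "bounded_linear T"
      unfolding T_def by (intro bounded_linear_intros psdD(1)[OF R])
    show "T u \<bullet> v = u \<bullet> T v" for u v
      by (simp add: T_def inner_diff_left inner_diff_right psdD(2)[OF R])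
    show "0 \<le> T u \<bullet> u" for u
    proof -
      have "R u \<bullet> u \<le> norm u * k * norm u"
        using norm_cauchy_schwarz[of "R u" u] mult_right_mono[OF k(2)[of u] norm_ge_zero[of u]]
        by linarith
      also have "\<dots> = k * (u \<bullet> u)" by (simp add: dot_square_norm power2_eq_square)
      finally show ?thesis using k(1) by (simp add: T_def inner_diff_left field_simps)
    qed
  qed
  have le: "T u \<bullet> u \<le> u \<bullet> u" for u
    using psdD(3)[OF R, of u] k(1) by (simp add: T_def inner_diff_left)
  have "norm (T x) \<le> norm x" for x
  proof (cases "T x = 0")
    case False
    \<comment> \<open>Cauchy-Schwarz in the form of \<open>T\<close> turns the form bound
      \<open>T \<le> 1\<close> into the norm bound.\<close>
    have "(T x \<bullet> T x)\<^sup>2 \<le> (T x \<bullet> x) * (T (T x) \<bullet> T x)"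
      by (rule psd_CauchySchwarz[OF \<open>psd T\<close>])
    also have "\<dots> \<le> (x \<bullet> x) * (T x \<bullet> T x)"
      using le psdD(3)[OF \<open>psd T\<close>] by (intro mult_mono) auto
    finally have "T x \<bullet> T x \<le> x \<bullet> x" using False by (simp add: power2_eq_square)
    then show ?thesis by (simp add: norm_le)
  qed simp
  then obtain Q where Q: "psd Q" "\<And>x. Q (Q x) = x - T x"
      "\<And>P x. bounded_linear P \<Longrightarrow> (\<And>x. P (T x) = T (P x)) \<Longrightarrow> P (Q x) = Q (P x)"
    using psd_sqrt_contraction[OF \<open>psd T\<close>] by blast
  define Q' where "Q' = (\<lambda>x. sqrt k *\<^sub>R Q x)"
  have "psd Q'"
    using psdD[OF Q(1)] k(1)
    by (auto simp: psd_def Q'_def intro!: bounded_linear_const_scaleR)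
  moreover have "Q' (Q' x) = R x" for x
    using k(1) by (simp add: Q'_def linear_scale[OF bounded_linear.linear[OF psdD(1)[OF Q(1)]]] Q(2) T_def)
  moreover have "P (Q' x) = Q' (P x)" if P: "bounded_linear P" "\<And>x. P (R x) = R (P x)" for P x
  proof -
    interpret P: bounded_linear P by (rule P(1))
    have "P (T x) = T (P x)" for x by (simp add: T_def P.diff P.scaleR P(2))
    then show ?thesis by (simp add: Q'_def P.scaleR Q(3)[OF P(1)])
  qed
  ultimately show ?thesis using that by blast
qed

text \<open>\<open>P\<close> and \<open>Q\<close> are not known to commute with each other. Both are
  compared with the constructed root \<open>B\<close>, which commutes with whatever commutes with
  the common square, in particular with each root.\<close>

lemma psd_sqrt_unique:
  fixes P Q :: "'a::{real_inner, complete_space} \<Rightarrow> 'a"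
  assumes "psd P" "psd Q" "\<And>x. P (P x) = Q (Q x)"
  shows "P = Q"
proof -
  obtain B where B: "psd B" "\<And>x. B (B x) = Q (Q x)"
    "\<And>P x. bounded_linear P \<Longrightarrow> (\<And>x. P (Q (Q x)) = Q (Q (P x))) \<Longrightarrow> P (B x) = B (P x)"
    using psd_sqrt_commuting[OF psd_square[OF assms(2)]] by blast
  have eq: "C x = B x" if C: "psd C" "\<And>x. C (C x) = Q (Q x)" for C x
  proof -
    interpret B: bounded_linear B using psdD(1)[OF B(1)] .
    interpret C: bounded_linear C using psdD(1)[OF C(1)] .
    have "C (Q (Q x)) = Q (Q (C x))" for x by (simp flip: C(2))
    then have comm: "C (B x) = B (C x)" for x by (rule B(3)[OF psdD(1)[OF C(1)]])
    define y where "y = B x - C x"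
    \<comment> \<open>This is \<open>(B + C) (B - C) x = B (B x) - C (C x)\<close>. Two nonnegative
      forms with zero sum vanish, so \<open>B y = C y = 0\<close>, and
      \<open>y \<bullet> y = x \<bullet> (B y - C y)\<close> vanishes too.\<close>
    have "B y + C y = 0" by (simp add: y_def B.diff C.diff comm B(2) C(2))
    then have "B y \<bullet> y + C y \<bullet> y = 0" by (simp flip: inner_add_left)
    then have "B y \<bullet> y = 0" "C y \<bullet> y = 0"
      using psdD(3)[OF B(1), of y] psdD(3)[OF C(1), of y] by auto
    then have "B y = 0" "C y = 0" using psd_zeroI B(1) C(1) by auto
    then have "y \<bullet> y = 0"
      by (simp add: y_def inner_diff_left psdD(2)[OF B(1)] psdD(2)[OF C(1)])
    then show ?thesis by (simp add: y_def)
  qed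
  show ?thesis using eq[OF assms(1,3)] eq[OF assms(2)] by auto
qed

text \<open>Density of \<open>range Q\<close> is the dense domain demanded of a self-adjoint graph.
  For uniqueness, any competing graph is itself the inverse of a bounded positive \<open>P\<close>
  with \<open>P\<^sup>2 = Q\<^sup>2\<close>.\<close>

lemma op_sqrt_inverse:
  fixes Q :: "'a::{real_inner, complete_space} \<Rightarrow> 'a"
  assumes Q: "psd Q" "inj Q" and dense: "closure (range Q) = UNIV"
  shows "op_sqrt {(Q (Q w), w) | w. True} = {(Q w, w) | w. True}"
  unfolding op_sqrt_def
proof (rule the_equality)
  interpret Q: bounded_linear Q using psdD(1)[OF Q(1)] .
  have "linear_op {(Q w, w) | w. True}"
  proof -
    have "{(Q w, w) | w. True} = range (\<lambda>w. (Q w, w))" by auto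
    moreover have "linear (\<lambda>w. (Q w, w))"
      by (intro bounded_linear.linear bounded_linear_Pair Q.bounded_linear_axioms bounded_linear_ident)
    ultimately have "subspace {(Q w, w) | w. True}"
      using linear_subspace_image[OF _ subspace_UNIV] by simp
    moreover have "single_valued {(Q w, w) | w. True}"
      by (rule single_valuedI) (auto dest: injD[OF \<open>inj Q\<close>])
    ultimately show ?thesis by (simp add: linear_op_def)
  qed
  moreover have "densely_defined {(Q w, w) | w. True}"
    using dense by (simp add: densely_defined_def Domain_unfold image_def)
  moreover have "op_adjoint {(Q w, w) | w. True} = {(Q w, w) | w. True}"
  proof -
    have "(u, w) \<in> op_adjoint {(Q w, w) | w. True} \<longleftrightarrow> u = Q w" for u w
    proof -
      have "(u, w) \<in> op_adjoint {(Q w, w) | w. True} \<longleftrightarrow> (\<forall>z. z \<bullet> u = z \<bullet> Q w)"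
        by (auto simp: op_adjoint_def psdD(2)[OF Q(1)])
      then show ?thesis using vector_eq_ldot by auto
    qed
    then show ?thesis by auto
  qed
  moreover have "op_bounded_below {(Q w, w) | w. True} 0"
    using psdD(3)[OF Q(1)] by (auto simp: op_bounded_below_def inner_commute)
  moreover have "{(Q w, w) | w. True} O {(Q w, w) | w. True} = {(Q (Q w), w) | w. True}"
    by auto
  ultimately show "self_adjoint_op {(Q w, w) |w. True} \<and>
      op_bounded_below {(Q w, w) |w. True} 0 \<and>
      {(Q w, w) |w. True} O {(Q w, w) |w. True} = {(Q (Q w), w) |w. True}"
    by (simp add: self_adjoint_op_def)
next
  interpret Q: bounded_linear Q using psdD(1)[OF Q(1)] .
  fix B assume B: "self_adjoint_op B \<and> op_bounded_below B 0 \<and> B O B = {(Q (Q w), w) |w. True}"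
  then have L: "linear_op B" by (simp add: self_adjoint_op_def)
  have inj: "u = v" if "(u, w) \<in> B" "(v, w) \<in> B" for u v w
  proof -
    \<comment> \<open>A kernel vector of \<open>B\<close> is one of \<open>B O B\<close>, hence
      equals \<open>Q (Q 0) = 0\<close>.\<close>
    have "(u - v, 0) \<in> B" using linear_op_diff[OF L that] by simp
    then have "(u - v, 0) \<in> B O B" using linear_op_zero[OF L] by auto
    then show ?thesis using B by (auto simp: Q.zero)
  qed
  have "\<exists>u. (u, w) \<in> B" for w
  proof -
    have "(Q (Q w), w) \<in> B O B" using B by auto
    then show ?thesis by auto
  qed
  then obtain P where P: "\<And>w. (P w, w) \<in> B" by metis
  have "(u, w) \<in> B \<longleftrightarrow> u = P w" for u w using P inj by blast
  then have B_eq: "B = {(P w, w) | w. True}" by auto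
  have PP: "P (P w) = Q (Q w)" for w
  proof -
    have "(P (P w), w) \<in> B O B" using P by auto
    then show ?thesis using B by auto
  qed
  have sym: "P u \<bullet> v = u \<bullet> P v" for u v
  proof -
    have "(P v, v) \<in> op_adjoint B" using B P by (simp add: self_adjoint_op_def)
    then show ?thesis using P[of u] by (force simp: op_adjoint_def)
  qed
  obtain k where k: "0 \<le> k" "\<And>x. norm (Q x) \<le> norm x * k" using Q.nonneg_bounded by blast
  have "bounded_linear P"
  proof (rule bounded_linear_intro)
    show "P (x + y) = P x + P y" for x y by (intro inj[OF P] linear_op_add[OF L] P)
    show "P (r *\<^sub>R x) = r *\<^sub>R P x" for r x by (intro inj[OF P] linear_op_scale[OF L] P)
    show "norm (P x) \<le> norm x * k" for x
    proof -
      \<comment> \<open>Both sides are the form of the common square, so \<open>P\<close> inherits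
        the bound of \<open>Q\<close>.\<close>
      have "P x \<bullet> P x = Q x \<bullet> Q x"
        using sym[of x "P x"] psdD(2)[OF Q(1), of x "Q x"] by (simp add: PP)
      then show ?thesis using k(2)[of x] by (simp add: norm_eq_sqrt_inner)
    qed
  qed
  moreover have "0 \<le> P x \<bullet> x" for x
    using B P[of x] by (force simp: op_bounded_below_def inner_commute)
  ultimately have "psd P" using sym by (simp add: psd_def)
  then show "B = {(Q w, w) | w. True}"
    using psd_sqrt_unique[OF _ Q(1) PP] B_eq by simp
qed

section \<open>Perturbations of sub-differentials\<close>

lemma maximal_monotone_relD:
  assumes "maximal_monotone_rel R" "\<And>y y'. (y, y') \<in> R \<Longrightarrow> 0 \<le> (x' - y') \<bullet> (x - y)"
  shows "(x, x') \<in> R"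
proof (rule ccontr)
  assume "(x, x') \<notin> R"
  moreover have "0 \<le> (y' - x') \<bullet> (y - x)" if "(y, y') \<in> R" for y y'
    using assms(2)[OF that] by (simp add: inner_diff_left inner_diff_right)
  then have "monotone_rel (insert (x, x') R)"
    using assms by (auto simp: monotone_rel_def maximal_monotone_rel_def)
  ultimately show False using assms(1) unfolding maximal_monotone_rel_def by blast
qed

text \<open>The easy half of Minty's criterion: two monotonically related pairs with the same sum of
  components coincide, since then \<open>x' - y' = - (x - y)\<close>.\<close>

lemma maximal_monotone_relI:
  assumes "monotone_rel R" and surj: "\<And>f. \<exists>x x'. (x, x') \<in> R \<and> x' + x = f"
  shows "maximal_monotone_rel R"
proof -
  have "p \<in> R" if R': "monotone_rel R'" "R \<subseteq> R'" and p: "p \<in> R'" for R' p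
  proof -
    obtain x x' where xx: "p = (x, x')" by force
    obtain y y' where y: "(y, y') \<in> R" "y' + y = x' + x" using surj by blast
    have "0 \<le> (x' - y') \<bullet> (x - y)"
      using R' p y(1) unfolding xx monotone_rel_def by blast
    moreover have "x' - y' = - (x - y)" using y(2) by (simp add: algebra_simps)
    ultimately have "(x - y) \<bullet> (x - y) \<le> 0" by (metis inner_minus_left neg_0_le_iff_le)
    then have "x = y" by (meson inner_gt_zero_iff not_less right_minus_eq)
    then show ?thesis using y xx by simp
  qed
  then show ?thesis using assms(1) unfolding maximal_monotone_rel_def by blast
qed

lemma subdifferential_finite:
  assumes "proper_convex f" "(x, x') \<in> subdifferential f"
  shows "\<bar>f x\<bar> \<noteq> \<infinity>"
proof -
  obtain y where "f y \<noteq> \<infinity>" using assms by (auto simp: proper_convex_def)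
  moreover have "f x \<le> f y + ereal (x' \<bullet> (x - y))" using assms(2) by (auto simp: subdifferential_def)
  moreover have "f x \<noteq> - \<infinity>" using assms by (auto simp: proper_convex_def)
  ultimately show ?thesis by (cases "f x"; cases "f y") auto
qed

lemma subdifferential_real:
  assumes "proper_convex f" "(x, x') \<in> subdifferential f" "(y, y') \<in> subdifferential f"
  shows "real_of_ereal (f x) \<le> real_of_ereal (f y) + x' \<bullet> (x - y)"
proof -
  have "f x \<le> f y + ereal (x' \<bullet> (x - y))" using assms(2) by (auto simp: subdifferential_def)
  then show ?thesis
    using subdifferential_finite[OF assms(1,2)] subdifferential_finite[OF assms(1,3)]
    by (cases "f x"; cases "f y") auto
qed

lemma monotone_subdifferential:
  assumes "proper_convex f"
  shows "monotone_rel (subdifferential f)"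
  unfolding monotone_rel_def
proof clarify
  fix x x' y y' assume *: "(x, x') \<in> subdifferential f" "(y, y') \<in> subdifferential f"
  show "0 \<le> (x' - y') \<bullet> (x - y)"
    using subdifferential_real[OF assms *] subdifferential_real[OF assms *(2,1)]
    by (simp add: inner_diff_left inner_diff_right)
qed

text \<open>The direct method is applied to the function whose epigraph \<open>E\<close> is cut out by the
  subgradients of \<open>f\<close>: unlike \<open>f\<close>, it is certainly lower semicontinuous, and by maximality it has
  the same subdifferential.\<close>

lemma subdifferential_plus_coercive_surj:
  fixes f :: "'a::{real_inner, complete_space} \<Rightarrow> ereal"
  assumes f: "proper_convex f" and max: "maximal_monotone_rel (subdifferential f)"
    and C: "psd C" and \<delta>: "0 < \<delta>" "\<And>x. \<delta> * (norm x)\<^sup>2 \<le> C x \<bullet> x"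
  obtains x where "(x, g - C x) \<in> subdifferential f"
proof -
  interpret C: bounded_linear C using psdD(1)[OF C] .
  define h where "h = (\<lambda>y. real_of_ereal (f y))"
  define E where "E = {(x, r). \<forall>(y, y')\<in>subdifferential f. h y + y' \<bullet> (x - y) \<le> r}"
  have inE: "(y, h y) \<in> E" if "(y, y') \<in> subdifferential f" for y y'
    using subdifferential_real[OF f _ that]
    by (fastforce simp: E_def h_def inner_diff_right)
  have "subdifferential f \<noteq> {}"
  proof
    assume "subdifferential f = {}"
    then have "(0, 0) \<in> subdifferential f" by (intro maximal_monotone_relD[OF max]) auto
    then show False using \<open>subdifferential f = {}\<close> by simp
  qed
  then obtain y0 y0' where y0: "(y0, y0') \<in> subdifferential f" by auto
  define j where "j = (\<lambda>(x, r). r + (C x \<bullet> x) / 2 - g \<bullet> x)"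
  \<comment> \<open>One subgradient at \<open>y0\<close> gives an affine minorant; completing the
    square against \<delta> absorbs its linear part together with \<open>g\<close>.\<close>
  define c where "c = h y0 - y0' \<bullet> y0 - (norm (y0' - g))\<^sup>2 / (2 * \<delta>)"
  have lower: "c \<le> j (x, r)" if "(x, r) \<in> E" for x r
  proof -
    have "h y0 + y0' \<bullet> (x - y0) \<le> r" using that y0 by (auto simp: E_def)
    moreover have "- (norm (y0' - g) * norm x) \<le> (y0' - g) \<bullet> x"
      using Cauchy_Schwarz_ineq2[of "y0' - g" x] by (simp add: abs_le_iff)
    moreover have "0 \<le> \<delta> / 2 * (norm x - norm (y0' - g) / \<delta>)\<^sup>2" using \<delta> by simp
    moreover have "\<delta> / 2 * (norm x - norm (y0' - g) / \<delta>)\<^sup>2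
        = \<delta> * (norm x)\<^sup>2 / 2 - norm (y0' - g) * norm x + (norm (y0' - g))\<^sup>2 / (2 * \<delta>)"
      using \<delta> by (simp add: power2_eq_square field_simps)
    ultimately show ?thesis using \<delta>(2)[of x]
      unfolding j_def c_def by (simp add: inner_diff_left inner_diff_right)
  qed
  have E_convex: "((1 - t) *\<^sub>R x + t *\<^sub>R y, (1 - t) * r + t * s) \<in> E"
    if "(x, r) \<in> E" "(y, s) \<in> E" "0 \<le> t" "t \<le> 1" for x y r s t
    unfolding E_def
  proof clarify
    fix z z' assume z: "(z, z') \<in> subdifferential f"
    have "(1 - t) * (h z + z' \<bullet> (x - z)) + t * (h z + z' \<bullet> (y - z)) \<le> (1 - t) * r + t * s"
      using that z by (intro add_mono mult_left_mono) (auto simp: E_def)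
    then show "h z + z' \<bullet> ((1 - t) *\<^sub>R x + t *\<^sub>R y - z) \<le> (1 - t) * r + t * s"
      by (simp add: inner_diff_right inner_add_right algebra_simps)
  qed
  define m where "m = Inf (j ` E)"
  have bdd: "bdd_below (j ` E)" using lower by (intro bdd_belowI[of _ c]) auto
  have ne: "j ` E \<noteq> {}" using inE[OF y0] by auto
  have m: "m \<le> j (x, r)" if "(x, r) \<in> E" for x r
    unfolding m_def using that bdd by (intro cInf_lower) auto
  define \<epsilon> :: "nat \<Rightarrow> real" where "\<epsilon> = (\<lambda>n. inverse (real (Suc n)))"
  have \<epsilon>0: "\<epsilon> \<longlonglongrightarrow> 0" unfolding \<epsilon>_def by (rule LIMSEQ_inverse_real_of_nat)
  have "\<exists>p\<in>E. j p < m + \<epsilon> n" for n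
    using cInf_lessD[OF ne, of "m + \<epsilon> n"] by (auto simp: m_def \<epsilon>_def)
  then obtain p where p: "\<And>n. p n \<in> E" "\<And>n. j (p n) < m + \<epsilon> n" by metis
  define v r where "v = (\<lambda>n. fst (p n))" and "r = (\<lambda>n. snd (p n))"
  have vr: "(v n, r n) \<in> E" and jvr: "j (v n, r n) < m + \<epsilon> n" for n
    using p[of n] by (simp_all add: v_def r_def)
  \<comment> \<open>The parallelogram law again: \<open>r\<close> and \<open>g\<close> enter
    \<open>j\<close> affinely and cancel, leaving only the form of \<open>C\<close>.\<close>
  have dist: "\<delta> * (norm (v i - v k))\<^sup>2 \<le> 4 * (\<epsilon> i + \<epsilon> k)" for i k
  proof -
    define M where "M = j ((1/2) *\<^sub>R v i + (1/2) *\<^sub>R v k, (1/2) * r i + (1/2) * r k)"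
    have "m \<le> M" unfolding M_def using E_convex[OF vr vr, of "1/2"] by (intro m) auto
    moreover have "C (v i - v k) \<bullet> (v i - v k) = 4 * (j (v i, r i) + j (v k, r k) - 2 * M)"
      unfolding j_def M_def
      by (simp add: C.add C.diff C.scaleR inner_add_left inner_add_right inner_diff_left
          inner_diff_right field_simps)
    ultimately show ?thesis
      using \<delta>(2)[of "v i - v k"] jvr[of i] jvr[of k] by argo
  qed
  have "Cauchy v"
  proof (rule metric_CauchyI)
    fix e :: real assume "e > 0"
    then have "eventually (\<lambda>n. \<epsilon> n < \<delta> * e\<^sup>2 / 8) sequentially"
      using order_tendstoD(2)[OF \<epsilon>0, of "\<delta> * e\<^sup>2 / 8"] \<delta> by simp
    then obtain N where N: "\<And>n. n \<ge> N \<Longrightarrow> \<epsilon> n < \<delta> * e\<^sup>2 / 8" by (auto simp: eventually_sequentially)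
    have "dist (v i) (v k) < e" if "i \<ge> N" "k \<ge> N" for i k
    proof -
      have "\<delta> * (norm (v i - v k))\<^sup>2 < \<delta> * e\<^sup>2"
        using N[OF that(1)] N[OF that(2)] dist[of i k] by argo
      then have "(norm (v i - v k))\<^sup>2 < e\<^sup>2" using \<delta>(1) by simp
      then show ?thesis using \<open>e > 0\<close> unfolding dist_norm by (rule power2_less_imp_less[OF _ less_imp_le])
    qed
    then show "\<exists>N. \<forall>i\<ge>N. \<forall>k\<ge>N. dist (v i) (v k) < e" by blast
  qed
  then obtain x where x: "v \<longlonglongrightarrow> x" using Cauchy_convergent by (auto simp: convergent_def)
  have jlim: "(\<lambda>n. j (v n, r n)) \<longlonglongrightarrow> m"
  proof (rule tendsto_sandwich[of "\<lambda>_. m" _ _ "\<lambda>n. m + \<epsilon> n"])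
    show "(\<lambda>n. m + \<epsilon> n) \<longlonglongrightarrow> m" using tendsto_add[OF tendsto_const \<epsilon>0] by simp
  qed (use m[OF vr] less_imp_le[OF jvr] in auto)
  \<comment> \<open>\<open>r n\<close> is recovered from \<open>j\<close> and \<open>v n\<close>, so
    it converges as well, and closedness of \<open>E\<close> keeps the limit in
    \<open>E\<close>.\<close>
  define r0 where "r0 = m - (C x \<bullet> x) / 2 + g \<bullet> x"
  have "(\<lambda>n. j (v n, r n) - (C (v n) \<bullet> v n) / 2 + g \<bullet> v n) \<longlonglongrightarrow> r0"
    unfolding r0_def by (intro tendsto_intros jlim x C.tendsto) auto
  then have rlim: "r \<longlonglongrightarrow> r0" by (simp add: j_def)
  have xE: "(x, r0) \<in> E"
    unfolding E_def
  proof clarify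
    fix y y' assume y: "(y, y') \<in> subdifferential f"
    have "(\<lambda>n. h y + y' \<bullet> (v n - y)) \<longlonglongrightarrow> h y + y' \<bullet> (x - y)" by (intro tendsto_intros x)
    then show "h y + y' \<bullet> (x - y) \<le> r0"
      by (rule LIMSEQ_le[OF _ rlim]) (use vr y in \<open>fastforce simp: E_def\<close>)
  qed
  have "(x, g - C x) \<in> subdifferential f"
  proof (rule maximal_monotone_relD[OF max])
    fix y y' assume y: "(y, y') \<in> subdifferential f"
    define d where "d = y - x"
    define a b where "a = (h y - r0) + (C x - g) \<bullet> d" and "b = (C d \<bullet> d) / 2"
    \<comment> \<open>First variation along the segment from the minimiser \<open>(x, r0)\<close> to
      \<open>(y, h y)\<close>, divided by \<open>t\<close>; letting \<open>t\<close> tend to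
      \<open>0\<close> leaves \<open>0 \<le> a\<close>.\<close>
    have pos: "0 \<le> a + t * b" if t: "0 < t" "t \<le> 1" for t
    proof -
      have "m \<le> j ((1 - t) *\<^sub>R x + t *\<^sub>R y, (1 - t) * r0 + t * h y)"
        by (intro m E_convex xE inE[OF y]) (use t in auto)
      also have "(1 - t) *\<^sub>R x + t *\<^sub>R y = x + t *\<^sub>R d"
        by (simp add: d_def algebra_simps)
      also have "j (x + t *\<^sub>R d, (1 - t) * r0 + t * h y) = m + t * (a + t * b)"
      proof -
        have "C (x + t *\<^sub>R d) \<bullet> (x + t *\<^sub>R d) = C x \<bullet> x + 2 * t * (C x \<bullet> d) + t * t * (C d \<bullet> d)"
          using psdD(2)[OF C, of d x]
          by (simp add: C.add C.scaleR inner_add_left inner_add_right inner_commute[of d "C x"]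
              algebra_simps)
        then show ?thesis
          by (simp add: j_def a_def b_def r0_def inner_add_right inner_diff_left field_simps)
      qed
      finally show ?thesis using t by (simp add: zero_le_mult_iff)
    qed
    have "(\<lambda>n. a + \<epsilon> n * b) \<longlonglongrightarrow> a + 0 * b" by (intro tendsto_intros \<epsilon>0)
    moreover have "0 \<le> a + \<epsilon> n * b" for n
      by (rule pos) (auto simp: \<epsilon>_def field_simps)
    ultimately have "0 \<le> a" by (intro LIMSEQ_le_const[of _ a 0]) auto
    \<comment> \<open>Added to \<open>0 \<le> a\<close>, this eliminates \<open>r0\<close> and
      \<open>h y\<close> and leaves exactly the monotonicity test against
      \<open>(y, y')\<close>.\<close>
    moreover have "h y + y' \<bullet> (x - y) \<le> r0" using xE y by (auto simp: E_def)
    ultimately show "0 \<le> (g - C x - y') \<bullet> (x - y)"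
      by (simp add: a_def d_def inner_diff_left inner_diff_right)
  qed
  then show ?thesis using that by blast
qed

text \<open>Uniform boundedness: were \<open>G\<close> not bounded below, there would be \<open>\<xi> n\<close> of norm \<open>n\<close> with
  \<open>norm (G (\<xi> n)) \<le> 1\<close>, and these are weakly bounded because \<open>K\<close> is onto.\<close>

lemma adjoint_of_surj_bounded_below:
  fixes K :: "'a::real_inner \<Rightarrow> 'b::{real_inner, complete_space}"
  assumes G: "linear G" and adj: "\<And>x y. K x \<bullet> y = x \<bullet> G y" and surj: "surj K"
  obtains \<delta> where "0 < \<delta>" "\<And>y. \<delta> * norm y \<le> norm (G y)"
proof (rule ccontr)
  assume neg: "\<not> thesis"
  have "\<exists>y. norm y = real n \<and> norm (G y) \<le> 1" for n
  proof -
    have "\<not> (\<forall>y. 1 / real (Suc n) * norm y \<le> norm (G y))"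
      using neg that[of "1 / real (Suc n)"] by auto
    then obtain y where y: "norm (G y) < 1 / real (Suc n) * norm y" by (auto simp: not_le)
    then have "norm y > 0" using norm_ge_zero[of "G y"] by (cases "y = 0") auto
    define z where "z = (real n / norm y) *\<^sub>R y"
    have "norm (G z) = (real n / norm y) * norm (G y)"
      by (simp add: z_def linear_scale[OF G])
    also have "\<dots> \<le> (real n / norm y) * (1 / real (Suc n) * norm y)"
      using y by (intro mult_left_mono) auto
    also have "\<dots> \<le> 1" using \<open>norm y > 0\<close> by (simp add: field_simps)
    finally show ?thesis using \<open>norm y > 0\<close> by (intro exI[of _ z]) (simp add: z_def)
  qed
  then obtain \<xi> where \<xi>: "\<And>n. norm (\<xi> n) = real n" "\<And>n. norm (G (\<xi> n)) \<le> 1" by metis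
  define T where "T = (\<lambda>k::nat. {x. \<forall>n. \<bar>\<xi> n \<bullet> x\<bar> \<le> real k})"
  have closed: "closed (T k)" for k
    unfolding T_def Collect_all_eq
    by (intro closed_INT ballI closed_Collect_le continuous_intros)
  have "interior (T k) = {}" for k
  proof (rule ccontr)
    assume "interior (T k) \<noteq> {}"
    then obtain x0 e where e: "e > 0" "cball x0 e \<subseteq> T k"
      by (metis all_not_in_conv mem_interior_cball)
    have bound: "e * real n \<le> 2 * real k" for n
    proof (cases n)
      case (Suc n')
      \<comment> \<open>The radius in the direction of \<open>\<xi> n\<close>: \<open>x0\<close> and
        \<open>x0 + d\<close> both lie in \<open>T k\<close>, so \<open>e * real n\<close> is at
        most \<open>2 * real k\<close> for every \<open>n\<close>, which is absurd.\<close>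
      define d where "d = (e / real n) *\<^sub>R \<xi> n"
      have "norm d = e" using Suc e by (simp add: d_def \<xi>)
      then have "x0 + d \<in> T k" "x0 \<in> T k" using e by (auto simp: dist_norm)
      then have "\<bar>\<xi> n \<bullet> (x0 + d)\<bar> \<le> real k" "\<bar>\<xi> n \<bullet> x0\<bar> \<le> real k" by (auto simp: T_def)
      moreover have "\<xi> n \<bullet> d = e * real n"
        using Suc \<xi>(1)[of n] by (simp add: d_def dot_square_norm power2_eq_square)
      ultimately show ?thesis by (simp add: inner_add_right)
    qed simp
    obtain n :: nat where "2 * real k / e < real n" using reals_Archimedean2 by blast
    then show False using bound[of n] e(1) by (simp add: field_simps)
  qed
  then have "(euclidean :: 'b topology) interior_of \<Union> (range T) = {}"
    using closed
    by (intro Baire_category_alt disjI1 completely_metrizable_space_euclidean) auto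
  moreover have "\<Union> (range T) = UNIV"
  proof -
    have "y \<in> \<Union> (range T)" for y
    proof -
      obtain x where x: "y = K x" using surj by auto
      obtain k where k: "norm x \<le> real k" using real_arch_simple by blast
      have "\<bar>\<xi> n \<bullet> y\<bar> \<le> real k" for n
      proof -
        have "\<bar>\<xi> n \<bullet> y\<bar> = \<bar>x \<bullet> G (\<xi> n)\<bar>" by (simp add: x adj inner_commute[of "\<xi> n" "K x"])
        also have "\<dots> \<le> norm x * norm (G (\<xi> n))" by (rule Cauchy_Schwarz_ineq2)
        also have "\<dots> \<le> norm x * 1" by (intro mult_left_mono \<xi>) auto
        finally show ?thesis using k by simp
      qed
      then show ?thesis by (auto simp: T_def)
    qed
    then show ?thesis by auto
  qed
  ultimately show False by simp
qed

section \<open>The nonlinear extension and its potential\<close>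

text \<open>As \<open>1 + R\<close> is defined everywhere, weak solutions are solutions. With
  \<open>k\<close> a bound of \<open>R\<close>, \<open>norm f \<le> (1 + k) * norm (P f)\<close> and
  \<open>(norm (P f))\<^sup>2 \<le> P f \<bullet> f\<close> give
  \<open>c = 1 / (1 + k)\<^sup>2\<close>.\<close>

lemma inverse_one_plus_psd:
  fixes R :: "'a::{real_inner, complete_space} \<Rightarrow> 'a"
  assumes R: "psd R"
  obtains P c where "psd P" "\<And>f. P f + R (P f) = f"
    "0 < c" "\<And>f. c * (norm f)\<^sup>2 \<le> P f \<bullet> f"
proof -
  interpret R: bounded_linear R using psdD(1)[OF R] .
  have sym: "symmetric_op {(x, x + R x) | x. True}"
    by (intro symmetric_op_graph bounded_linear_add bounded_linear_ident psdD(1)[OF R])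
      (simp add: inner_add_left inner_add_right psdD(2)[OF R])
  have bb: "op_bounded_below {(x, x + R x) | x. True} 1"
    using psdD(3)[OF R]
    by (auto simp: op_bounded_below_def inner_add_left power2_norm_eq_inner)
  have "\<exists>u. u + R u = f" for f
  proof -
    obtain u where u: "\<And>v z. (v, z) \<in> {(x, x + R x) | x. True} \<Longrightarrow> z \<bullet> u = v \<bullet> f"
      by (rule weak_solution[OF sym bb zero_less_one bounded_linear_inner_left]) (rule that)
    have "v \<bullet> (u + R u) = v \<bullet> f" for v
      using u[of v "v + R v"] by (auto simp: inner_add_left inner_add_right psdD(2)[OF R])
    then show ?thesis using vector_eq_ldot by blast
  qed
  then have "f \<in> Range {(x, x + R x) | x. True}" for f by (auto simp: Range_iff) metis
  then have "Range {(x, x + R x) | x. True} = UNIV" by blast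
  then obtain P where P: "psd P" "{(x, x + R x) | x. True} = {(P w, w) | w. True}"
    by (rule symmetric_op_inverse[OF sym bb zero_less_one])
  have inv: "P f + R (P f) = f" for f
  proof -
    have "(P f, f) \<in> {(x, x + R x) | x. True}" unfolding P(2) by blast
    then show ?thesis by auto
  qed
  obtain k where k: "0 \<le> k" "\<And>x. norm (R x) \<le> norm x * k" using R.nonneg_bounded by blast
  have "1 / (1 + k)\<^sup>2 * (norm f)\<^sup>2 \<le> P f \<bullet> f" for f
  proof -
    have "norm f \<le> norm (P f) + norm (R (P f))"
      using norm_triangle_ineq[of "P f" "R (P f)"] by (simp add: inv)
    also have "\<dots> \<le> (1 + k) * norm (P f)" using k(2)[of "P f"] by (simp add: algebra_simps)
    finally have "(norm f)\<^sup>2 \<le> ((1 + k) * norm (P f))\<^sup>2" by (intro power_mono) auto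
    moreover have "0 < (1 + k)\<^sup>2" using k(1) by simp
    ultimately have "1 / (1 + k)\<^sup>2 * (norm f)\<^sup>2 \<le> (norm (P f))\<^sup>2"
      by (simp only: power_mult_distrib) (simp add: divide_le_eq mult.commute)
    also have "\<dots> \<le> P f \<bullet> (P f + R (P f))"
      using psdD(3)[OF R, of "P f"] by (simp add: inner_add_right power2_norm_eq_inner inner_commute)
    finally show ?thesis by (simp add: inv)
  qed
  moreover have "0 < 1 / (1 + k)\<^sup>2" using k(1) by (simp add: add_pos_nonneg)
  ultimately show ?thesis using that P(1) inv by blast
qed

text \<open>With \<open>R\<close> the inverse of \<open>A\<^sub>0 + l\<^sub>0\<close>, here \<open>Q\<close> is the square root of \<open>R\<close>, \<open>K\<close> is \<open>\<tau> R\<close> and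
  \<open>M\<close> is \<open>A_Theta + l\<^sub>0\<close>.\<close>

locale resolvent_model =
  fixes Q :: "'a::{real_inner, complete_space} \<Rightarrow> 'a"
    and K :: "'a \<Rightarrow> 'b::{real_inner, complete_space}"
    and G :: "'b \<Rightarrow> 'a"
    and \<phi> :: "'b \<Rightarrow> ereal"
  assumes psd_Q: "psd Q" and inj_Q: "inj Q"
    and bounded_linear_K: "bounded_linear K" and surj_K: "surj K"
    and bounded_linear_G: "bounded_linear G" and adj: "K x \<bullet> y = x \<bullet> G y"
    and range_G_Q: "range G \<inter> range Q = {0}"
    and \<phi>: "proper_convex \<phi>" and maximal: "maximal_monotone_rel (subdifferential \<phi>)"
begin

definition M :: "('a \<times> 'a) set" where
  "M = {(Q (Q w) + G \<xi>, w) | w \<xi>. (\<xi>, K w) \<in> subdifferential \<phi>}"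

definition Phi :: "'a \<Rightarrow> ereal" where
  "Phi u = (if \<exists>z \<xi>. \<xi> \<in> eff_domain \<phi> \<and> u = Q z + G \<xi>
     then THE r. \<exists>z \<xi>. \<xi> \<in> eff_domain \<phi> \<and> u = Q z + G \<xi> \<and> r = ereal ((norm z)\<^sup>2 / 2) + \<phi> \<xi>
     else \<infinity>)"

text \<open>The difference of two decompositions lies in both ranges, hence is \<open>0\<close>;
  then \<open>inj Q\<close> settles \<open>z\<close>, and \<xi> follows because \<open>G\<close> is
  injective, its adjoint \<open>K\<close> being onto.\<close>

lemma decomposition_unique:
  assumes "Q z + G \<xi> = Q z' + G \<xi>'"
  shows "z = z'" "\<xi> = \<xi>'"
proof -
  interpret Q: bounded_linear Q using psdD(1)[OF psd_Q] .
  interpret G: bounded_linear G by (rule bounded_linear_G)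
  have eq: "G (\<xi> - \<xi>') = Q (z' - z)" using assms by (simp add: G.diff Q.diff algebra_simps)
  then have "G (\<xi> - \<xi>') \<in> range G \<inter> range Q" by (metis IntI rangeI)
  then have 0: "G (\<xi> - \<xi>') = 0" using range_G_Q by simp
  then have "Q (z' - z) = Q 0" using eq by (simp add: Q.zero)
  then have "z' - z = 0" by (rule injD[OF inj_Q])
  then show "z = z'" by simp
  obtain x where "K x = \<xi> - \<xi>'" using surj_K by (metis surj_def)
  then have "(\<xi> - \<xi>') \<bullet> (\<xi> - \<xi>') = 0" using adj[of x "\<xi> - \<xi>'"] 0 by simp
  then show "\<xi> = \<xi>'" by simp
qed

text \<open>No domain condition on \<xi> is imposed: outside \<open>eff_domain \<phi>\<close> both
  sides are infinite. Later arguments can therefore ignore the conditional in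
  \<open>Phi\<close>.\<close>

lemma Phi_decomposition: "Phi (Q z + G \<xi>) = ereal ((norm z)\<^sup>2 / 2) + \<phi> \<xi>"
proof (cases "\<xi> \<in> eff_domain \<phi>")
  case True
  then have "(THE r. \<exists>z' \<xi>'. \<xi>' \<in> eff_domain \<phi> \<and> Q z + G \<xi> = Q z' + G \<xi>' \<and>
      r = ereal ((norm z')\<^sup>2 / 2) + \<phi> \<xi>') = ereal ((norm z)\<^sup>2 / 2) + \<phi> \<xi>"
    using decomposition_unique by (intro the_equality) blast+
  then show ?thesis using True unfolding Phi_def by auto
next
  case False
  then have "\<not> (\<exists>z' \<xi>'. \<xi>' \<in> eff_domain \<phi> \<and> Q z + G \<xi> = Q z' + G \<xi>')"
    using decomposition_unique(2) by blast
  then have "Phi (Q z + G \<xi>) = \<infinity>" unfolding Phi_def by (rule if_not_P)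
  then show ?thesis using False by (simp add: eff_domain_def)
qed

lemma Phi_cases:
  obtains (decomposed) z \<xi> where "u = Q z + G \<xi>" | (infinite) "Phi u = \<infinity>"
  unfolding Phi_def by metis

lemma phi_not_minf: "\<phi> \<xi> \<noteq> - \<infinity>"
  using \<phi> by (simp add: proper_convex_def)

lemma Phi_not_minf: "Phi u \<noteq> - \<infinity>"
  by (cases u rule: Phi_cases) (auto simp: Phi_decomposition phi_not_minf)

lemma proper_convex_Phi: "proper_convex Phi"
  unfolding proper_convex_def
proof (intro conjI allI impI Phi_not_minf)
  obtain \<xi> where "\<phi> \<xi> \<noteq> \<infinity>" using \<phi> by (auto simp: proper_convex_def)
  then have "Phi (Q 0 + G \<xi>) \<noteq> \<infinity>" unfolding Phi_decomposition by simp
  then show "\<exists>x. Phi x \<noteq> \<infinity>" by blast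
next
  interpret Q: bounded_linear Q using psdD(1)[OF psd_Q] .
  interpret G: bounded_linear G by (rule bounded_linear_G)
  fix x y and s t :: real assume st: "0 < s" "0 < t" "s + t = 1"
  show "Phi (s *\<^sub>R x + t *\<^sub>R y) \<le> ereal s * Phi x + ereal t * Phi y"
  proof (cases x rule: Phi_cases)
    case infinite
    then show ?thesis using st Phi_not_minf[of y] by (cases "Phi y") auto
  next
    case x: (decomposed z \<xi>)
    show ?thesis
    proof (cases y rule: Phi_cases)
      case infinite
      then show ?thesis using st Phi_not_minf[of x] by (cases "Phi x") auto
    next
      case y: (decomposed z' \<xi>')
      have "s *\<^sub>R x + t *\<^sub>R y = Q (s *\<^sub>R z + t *\<^sub>R z') + G (s *\<^sub>R \<xi> + t *\<^sub>R \<xi>')"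
        by (simp add: x y Q.add Q.scaleR G.add G.scaleR algebra_simps)
      then have "Phi (s *\<^sub>R x + t *\<^sub>R y)
          = ereal ((norm (s *\<^sub>R z + t *\<^sub>R z'))\<^sup>2 / 2) + \<phi> (s *\<^sub>R \<xi> + t *\<^sub>R \<xi>')"
        by (simp only: Phi_decomposition)
      also have "\<dots> \<le> ereal (s * ((norm z)\<^sup>2 / 2) + t * ((norm z')\<^sup>2 / 2))
          + (ereal s * \<phi> \<xi> + ereal t * \<phi> \<xi>')"
      proof (rule add_mono)
        have s: "s = 1 - t" using st by simp
        \<comment> \<open>The exact convexity defect of the squared norm.\<close>
        have "s * (norm z)\<^sup>2 + t * (norm z')\<^sup>2 - (norm (s *\<^sub>R z + t *\<^sub>R z'))\<^sup>2
            = s * t * (norm (z - z'))\<^sup>2"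
          unfolding s power2_norm_eq_inner
          by (simp add: inner_add_left inner_add_right inner_diff_left inner_diff_right
              inner_commute[of z' z] algebra_simps)
        also have "\<dots> \<ge> 0" using st by simp
        finally show "ereal ((norm (s *\<^sub>R z + t *\<^sub>R z'))\<^sup>2 / 2)
            \<le> ereal (s * ((norm z)\<^sup>2 / 2) + t * ((norm z')\<^sup>2 / 2))" by simp
        show "\<phi> (s *\<^sub>R \<xi> + t *\<^sub>R \<xi>') \<le> ereal s * \<phi> \<xi> + ereal t * \<phi> \<xi>'"
          using \<phi> st by (simp add: proper_convex_def)
      qed
      also have "\<dots> = ereal s * Phi x + ereal t * Phi y"
        using st phi_not_minf[of \<xi>] phi_not_minf[of \<xi>'] unfolding x y Phi_decomposition
        by (cases "\<phi> \<xi>"; cases "\<phi> \<xi>'") (auto simp: algebra_simps)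
      finally show ?thesis .
    qed
  qed
qed

text \<open>The pairing with \<open>x - y\<close> splits: on the \<open>Q\<close> part it is
  \<open>Q w \<bullet> (Q w - z)\<close>, giving the subgradient inequality of half the squared norm
  at \<open>Q w\<close>; on the \<open>G\<close> part it is
  \<open>K w \<bullet> (\<xi> - \<eta>)\<close>, giving that of \<phi>.\<close>

lemma M_subset_subdifferential: "M \<subseteq> subdifferential Phi"
proof clarify
  interpret G: bounded_linear G by (rule bounded_linear_G)
  fix x w assume "(x, w) \<in> M"
  then obtain \<xi> where x: "x = Q (Q w) + G \<xi>" and \<xi>: "(\<xi>, K w) \<in> subdifferential \<phi>"
    by (auto simp: M_def)
  have "Phi x \<le> Phi y + ereal (w \<bullet> (x - y))" for y
  proof (cases y rule: Phi_cases)
    case y: (decomposed z \<eta>)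
    have "(norm (Q w))\<^sup>2 / 2 \<le> (norm z)\<^sup>2 / 2 + w \<bullet> (Q (Q w) - Q z)"
    proof -
      have "w \<bullet> (Q (Q w) - Q z) = Q w \<bullet> (Q w - z)"
        by (simp add: psdD(2)[OF psd_Q] inner_diff_right)
      moreover have "0 \<le> (norm (Q w - z))\<^sup>2" by simp
      ultimately show ?thesis
        by (simp add: power2_norm_eq_inner inner_diff_left inner_diff_right inner_commute[of z "Q w"])
    qed
    moreover have "\<phi> \<xi> \<le> \<phi> \<eta> + ereal (K w \<bullet> (\<xi> - \<eta>))"
      using \<xi> by (simp add: subdifferential_def)
    then have "\<phi> \<xi> \<le> \<phi> \<eta> + ereal (w \<bullet> (G \<xi> - G \<eta>))" by (simp only: adj G.diff)
    moreover have "w \<bullet> (x - y) = w \<bullet> (Q (Q w) - Q z) + w \<bullet> (G \<xi> - G \<eta>)"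
      by (simp add: x y inner_diff_right inner_add_right)
    ultimately show ?thesis
      unfolding x y Phi_decomposition
      using phi_not_minf[of \<xi>] phi_not_minf[of \<eta>]
      by (cases "\<phi> \<xi>"; cases "\<phi> \<eta>") (auto simp flip: x y)
  qed simp
  then show "(x, w) \<in> subdifferential Phi" by (simp add: subdifferential_def)
qed

lemma single_valued_M: "single_valued M"
proof (rule single_valuedI)
  fix x w w' assume "(x, w) \<in> M" "(x, w') \<in> M"
  then obtain \<xi> \<xi>' where "Q (Q w) + G \<xi> = Q (Q w') + G \<xi>'" by (auto simp: M_def)
  then have "Q w = Q w'" by (rule decomposition_unique)
  then show "w = w'" using inj_Q by (simp add: inj_eq)
qed

lemma monotone_M: "monotone_rel M"
  using monotone_subdifferential[OF proper_convex_Phi] M_subset_subdifferential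
  unfolding monotone_rel_def by blast

text \<open>Eliminating \<open>w\<close> from \<open>w + Q\<^sup>2 w + G \<xi> = f\<close> leaves the inclusion
  \<open>K P f \<in> (\<partial>\<phi> + K P G) \<xi>\<close> with \<open>P\<close> the inverse of \<open>1 + Q\<^sup>2\<close>.\<close>

lemma M_plus_one_surj: "\<exists>x w. (x, w) \<in> M \<and> w + x = f"
proof -
  interpret K: bounded_linear K by (rule bounded_linear_K)
  interpret G: bounded_linear G by (rule bounded_linear_G)
  obtain P c where P: "psd P" "\<And>f. P f + Q (Q (P f)) = f"
    and c: "0 < c" "\<And>f. c * (norm f)\<^sup>2 \<le> P f \<bullet> f"
    using inverse_one_plus_psd[OF psd_square[OF psd_Q]] by blast
  interpret P: bounded_linear P using psdD(1)[OF P(1)] .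
  obtain \<delta> where \<delta>: "0 < \<delta>" "\<And>y. \<delta> * norm y \<le> norm (G y)"
    using adjoint_of_surj_bounded_below[OF G.linear adj surj_K] by blast
  define C where "C = (\<lambda>\<xi>. K (P (G \<xi>)))"
  have "psd C"
    unfolding psd_def C_def
  proof (intro conjI allI)
    show "bounded_linear (\<lambda>\<xi>. K (P (G \<xi>)))"
      by (intro bounded_linear_compose[OF bounded_linear_K]
          bounded_linear_compose[OF psdD(1)[OF P(1)]] bounded_linear_G)
    show "K (P (G x)) \<bullet> y = x \<bullet> K (P (G y))" for x y
      using adj[of "P (G x)" y] adj[of "P (G y)" x] psdD(2)[OF P(1), of "G x" "G y"]
      by (simp add: inner_commute)
    show "0 \<le> K (P (G x)) \<bullet> x" for x using psdD(3)[OF P(1), of "G x"] by (simp add: adj)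
  qed
  \<comment> \<open>\<open>C \<xi> \<bullet> \<xi>\<close> is the form of \<open>P\<close> at
    \<open>G \<xi>\<close>; the constants are the lower bounds of \<open>P\<close> and of
    \<open>G\<close>.\<close>
  moreover have "c * \<delta>\<^sup>2 * (norm \<xi>)\<^sup>2 \<le> C \<xi> \<bullet> \<xi>" for \<xi>
  proof -
    have "(\<delta> * norm \<xi>)\<^sup>2 \<le> (norm (G \<xi>))\<^sup>2" using \<delta> by (intro power_mono) auto
    then have "c * (\<delta> * norm \<xi>)\<^sup>2 \<le> c * (norm (G \<xi>))\<^sup>2" using c(1) by simp
    then show ?thesis using c(2)[of "G \<xi>"] by (simp add: C_def adj power_mult_distrib mult.assoc)
  qed
  moreover have "0 < c * \<delta>\<^sup>2" using c(1) \<delta>(1) by simp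
  ultimately obtain \<xi> where \<xi>: "(\<xi>, K (P f) - C \<xi>) \<in> subdifferential \<phi>"
    using subdifferential_plus_coercive_surj[OF \<phi> maximal] by blast
  define w where "w = P (f - G \<xi>)"
  have "K w = K (P f) - C \<xi>" by (simp add: w_def C_def P.diff K.diff)
  then have "(Q (Q w) + G \<xi>, w) \<in> M" using \<xi> by (auto simp: M_def)
  moreover have "w + (Q (Q w) + G \<xi>) = f" using P(2)[of "f - G \<xi>"] by (simp add: w_def algebra_simps)
  ultimately show ?thesis by blast
qed

lemma maximal_monotone_M: "maximal_monotone_rel M"
  using monotone_M M_plus_one_surj by (rule maximal_monotone_relI)

lemma M_eq_subdifferential: "M = subdifferential Phi"
  using maximal_monotone_M monotone_subdifferential[OF proper_convex_Phi] M_subset_subdifferential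
  unfolding maximal_monotone_rel_def by blast

end

section \<open>Return to the unbounded operators\<close>

lemma maximal_monotone_op_of_type_shiftI:
  assumes "single_valued (op_shift A l)" "monotone_rel (op_shift A l)"
    and surj: "\<And>f. \<exists>x w. (x, w) \<in> op_shift A l \<and> w + x = f"
  shows "maximal_monotone_op_of_type l A"
  unfolding maximal_monotone_op_of_type_def
proof (intro conjI)
  have inM: "(u, w + l *\<^sub>R u) \<in> op_shift A l" if "(u, w) \<in> A" for u w
    using that by (auto simp: op_shift_def)
  show "single_valued A"
  proof (rule single_valuedI)
    fix u w z assume "(u, w) \<in> A" "(u, z) \<in> A"
    then have "w + l *\<^sub>R u = z + l *\<^sub>R u" using single_valuedD[OF assms(1) inM inM] by blast
    then show "w = z" by simp
  qed
  show "\<forall>(u, u')\<in>A. \<forall>(v, v')\<in>A. - l * (norm (u - v))\<^sup>2 \<le> (u' - v') \<bullet> (u - v)"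
  proof clarify
    fix u u' v v' assume uv: "(u, u') \<in> A" "(v, v') \<in> A"
    have "0 \<le> ((u' + l *\<^sub>R u) - (v' + l *\<^sub>R v)) \<bullet> (u - v)"
      using assms(2) inM[OF uv(1)] inM[OF uv(2)] by (auto simp: monotone_rel_def)
    also have "(u' + l *\<^sub>R u) - (v' + l *\<^sub>R v) = (u' - v') + l *\<^sub>R (u - v)"
      by (simp add: algebra_simps)
    finally show "- l * (norm (u - v))\<^sup>2 \<le> (u' - v') \<bullet> (u - v)"
      by (simp add: inner_add_left power2_norm_eq_inner)
  qed
  have "f \<in> Range (op_shift A (l + 1))" for f
  proof -
    obtain x w where "(x, w) \<in> op_shift A l" "w + x = f" using surj by blast
    then have "(x, f) \<in> op_shift A (l + 1)" by (auto simp: op_shift_iff algebra_simps)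
    then show ?thesis by blast
  qed
  then show "\<exists>k>l. Range (op_shift A k) = UNIV" by (intro exI[of _ "l + 1"]) auto
qed

lemma bounded_linear_if_continuous:
  fixes K :: "'a::real_normed_vector \<Rightarrow> 'b::real_normed_vector"
  assumes "linear K" "continuous_on UNIV K"
  shows "bounded_linear K"
proof -
  obtain d where d: "d > 0" "\<And>x. norm x < d \<Longrightarrow> norm (K x) < 1"
    using assms(2)[unfolded continuous_on_iff, rule_format, of 0 1] linear_0[OF assms(1)] by auto
  show ?thesis
  proof (rule bounded_linear_intro)
    show "K (x + y) = K x + K y" "K (r *\<^sub>R x) = r *\<^sub>R K x" for x y r
      by (simp_all add: linear_add[OF assms(1)] linear_scale[OF assms(1)])
    show "norm (K x) \<le> norm x * (2 / d)" for x
    proof (cases "x = 0")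
      case False
      \<comment> \<open>\<open>x\<close> is rescaled to norm \<open>d / 2\<close>, strictly inside
        the ball of radius \<open>d\<close>.\<close>
      have "norm (K ((d / (2 * norm x)) *\<^sub>R x)) < 1" using False d(1) by (intro d(2)) simp
      then show ?thesis using False d(1) by (simp add: linear_scale[OF assms(1)] field_simps)
    qed (simp add: linear_0[OF assms(1)])
  qed
qed

theorem theorem4p2:
  fixes S A\<^sub>0 :: "('a::{real_inner, complete_space} \<times> 'a) set"
    and \<tau> :: "'a \<Rightarrow> 'b::{real_inner, complete_space}"
    and \<omega> l\<^sub>0 :: real
    and \<phi> :: "'b \<Rightarrow> ereal"
  assumes "symmetric_op S" and "densely_defined S" and "op_bounded_below S (- \<omega>)"
    and "\<not> essentially_self_adjoint_op S"
    and "A\<^sub>0 = friedrichs_ext S"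
    and "graph_surjection A\<^sub>0 \<tau>"
    and "Domain S = {u \<in> Domain A\<^sub>0. \<tau> u = 0}"
    and "\<omega> < l\<^sub>0"
    and "proper_convex \<phi>"
    and "maximal_monotone_rel (subdifferential \<phi>)"
    and "range (G_op A\<^sub>0 \<tau> l\<^sub>0) \<inter> Domain (op_sqrt (op_shift A\<^sub>0 l\<^sub>0)) = {0}"
  shows "maximal_monotone_op_of_type l\<^sub>0 (A_Theta A\<^sub>0 \<tau> l\<^sub>0 (subdifferential \<phi>))
    \<and> proper_convex (Phi_pot A\<^sub>0 \<tau> l\<^sub>0 \<phi>)
    \<and> subpotential_maximal_monotone (op_shift (A_Theta A\<^sub>0 \<tau> l\<^sub>0 (subdifferential \<phi>)) l\<^sub>0)
    \<and> op_shift (A_Theta A\<^sub>0 \<tau> l\<^sub>0 (subdifferential \<phi>)) l\<^sub>0 = subdifferential (Phi_pot A\<^sub>0 \<tau> l\<^sub>0 \<phi>)"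
proof -
  define S' where "S' = op_shift S l\<^sub>0"
  define L where "L = op_shift A\<^sub>0 l\<^sub>0"
  have S': "symmetric_op S'" "op_bounded_below S' (l\<^sub>0 - \<omega>)" "densely_defined S'"
    using symmetric_op_shift[OF assms(1)] op_bounded_below_shift[OF assms(3), of l\<^sub>0] assms(2)
    by (simp_all add: S'_def densely_defined_def Domain_op_shift)
  have c: "0 < l\<^sub>0 - \<omega>" using assms(8) by simp
  have L_eq: "L = friedrichs_ext S'" by (simp add: L_def S'_def assms(5) friedrichs_ext_shift)
  have L: "symmetric_op L" "op_bounded_below L (l\<^sub>0 - \<omega>)" "Range L = UNIV"
    unfolding L_eq
    using symmetric_op_friedrichs_ext[OF S'(1) op_bounded_below_mono[OF S'(2)] S'(3)]
      op_bounded_below_friedrichs_ext[OF S'(1,2)] Range_friedrichs_ext[OF S'(1,2)] c by auto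
  obtain R where R: "psd R" "inj R" "L = {(R w, w) | w. True}"
    by (rule symmetric_op_inverse[OF L(1,2) c L(3)])
  obtain Q where Q: "psd Q" "\<And>x. Q (Q x) = R x"
    by (rule psd_sqrt_commuting[OF R(1)]) (rule that)
  have "inj Q" using R(2) by (metis Q(2) injI inj_eq)
  \<comment> \<open>\<open>Domain S \<subseteq> Domain L = range R \<subseteq> range Q\<close>, so
    density of \<open>Domain S\<close> passes to \<open>range Q\<close>.\<close>
  have "Domain S \<subseteq> range Q"
  proof -
    have "Domain S \<subseteq> Domain L" using assms(7) by (auto simp: L_def Domain_op_shift)
    moreover have "Domain L \<subseteq> range Q" by (auto simp: R(3) simp flip: Q(2))
    ultimately show ?thesis by (rule subset_trans)
  qed
  then have "closure (range Q) = UNIV"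
    using closure_mono[of "Domain S" "range Q"] assms(2) by (auto simp: densely_defined_def)
  then have sqrt: "op_sqrt L = {(Q w, w) | w. True}"
    using op_sqrt_inverse[OF Q(1) \<open>inj Q\<close>] by (simp add: R(3) Q(2))
  have inv: "op_inv L w = R w" for w
    unfolding op_inv_def R(3) by auto
  have in_A: "(u, w) \<in> A\<^sub>0 \<longleftrightarrow> u = R (w + l\<^sub>0 *\<^sub>R u)" for u w
  proof -
    have "(u, w) \<in> A\<^sub>0 \<longleftrightarrow> (u, w + l\<^sub>0 *\<^sub>R u) \<in> L" by (simp add: L_def op_shift_iff)
    then show ?thesis by (auto simp: R(3))
  qed
  interpret R: bounded_linear R using psdD(1)[OF R(1)] .
  define K where "K = (\<lambda>w. \<tau> (R w))"
  define G where "G = G_op A\<^sub>0 \<tau> l\<^sub>0"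
  have G: "G = adjoint K" by (simp add: G_def G_op_def K_def inv flip: L_def)
  have \<tau>: "\<And>u v. u \<in> Domain A\<^sub>0 \<Longrightarrow> v \<in> Domain A\<^sub>0 \<Longrightarrow> \<tau> (u + v) = \<tau> u + \<tau> v"
      "\<And>r u. u \<in> Domain A\<^sub>0 \<Longrightarrow> \<tau> (r *\<^sub>R u) = r *\<^sub>R \<tau> u"
      "continuous_on A\<^sub>0 (\<lambda>p. \<tau> (fst p))" "\<tau> ` Domain A\<^sub>0 = UNIV"
    using assms(6) by (auto simp: graph_surjection_def)
  have graph: "(R w, w - l\<^sub>0 *\<^sub>R R w) \<in> A\<^sub>0" for w by (simp add: in_A)
  have dom: "R w \<in> Domain A\<^sub>0" for w using graph by blast
  have "linear K"
    by (rule linearI) (simp_all add: K_def R.add R.scaleR \<tau>(1,2) dom)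
  moreover have "continuous_on UNIV K"
  proof -
    \<comment> \<open>\<tau> is continuous only for the graph norm, so \<open>K\<close> is factored
      through \<open>w \<mapsto> (R w, w - l\<^sub>0 *\<^sub>R R w)\<close>, a continuous map into
      the graph.\<close>
    have "continuous_on UNIV (\<lambda>w. \<tau> (fst (R w, w - l\<^sub>0 *\<^sub>R R w)))"
      by (rule continuous_on_compose2[OF \<tau>(3)])
        (use graph in \<open>auto intro!: continuous_intros R.continuous_on\<close>)
    then show ?thesis by (simp add: K_def)
  qed
  ultimately have K: "bounded_linear K" by (rule bounded_linear_if_continuous)
  have "y \<in> range K" for y
  proof -
    have "y \<in> \<tau> ` Domain A\<^sub>0" using \<tau>(4) by simp
    then obtain u w where uw: "(u, w) \<in> A\<^sub>0" "y = \<tau> u" by blast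
    have "u = R (w + l\<^sub>0 *\<^sub>R u)" using uw(1) by (simp only: in_A)
    then have "y = K (w + l\<^sub>0 *\<^sub>R u)" using uw(2) by (simp add: K_def)
    then show ?thesis by blast
  qed
  then have "surj K" by blast
  interpret resolvent_model Q K G \<phi>
  proof (rule resolvent_model.intro)
    show "range G \<inter> range Q = {0}"
      using assms(11) sqrt by (auto simp: G_def L_def Domain_unfold image_def)
  qed (use Q(1) \<open>inj Q\<close> K \<open>surj K\<close> adjoint_bounded_linear[OF K] assms(9,10) in \<open>auto simp: G\<close>)
  have Phi: "Phi_pot A\<^sub>0 \<tau> l\<^sub>0 \<phi> = Phi"
    by (rule ext) (auto simp: Phi_pot_def Phi_def sqrt simp flip: L_def G_def)
  have shift: "op_shift (A_Theta A\<^sub>0 \<tau> l\<^sub>0 (subdifferential \<phi>)) l\<^sub>0 = M"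
  proof -
    \<comment> \<open>The shift cancels \<open>- l\<^sub>0 *\<^sub>R G \<xi>\<close>, so
      \<open>f = w + l\<^sub>0 *\<^sub>R u\<close> and the regular part is
      \<open>u = R f\<close>.\<close>
    have "(x, f) \<in> op_shift (A_Theta A\<^sub>0 \<tau> l\<^sub>0 (subdifferential \<phi>)) l\<^sub>0 \<longleftrightarrow> (x, f) \<in> M" for x f
    proof -
      have "(x, f) \<in> op_shift (A_Theta A\<^sub>0 \<tau> l\<^sub>0 (subdifferential \<phi>)) l\<^sub>0
          \<longleftrightarrow> (\<exists>u w \<xi>. x = u + G \<xi> \<and> f = w + l\<^sub>0 *\<^sub>R u \<and> u = R (w + l\<^sub>0 *\<^sub>R u)
                \<and> (\<xi>, \<tau> u) \<in> subdifferential \<phi>)"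
        unfolding op_shift_iff A_Theta_def in_A G_def[symmetric]
        by (auto simp: algebra_simps) (metis add_diff_cancel diff_add_cancel)+
      also have "\<dots> \<longleftrightarrow> (\<exists>\<xi>. x = R f + G \<xi> \<and> (\<xi>, \<tau> (R f)) \<in> subdifferential \<phi>)"
        by (metis diff_add_cancel)
      also have "\<dots> \<longleftrightarrow> (x, f) \<in> M" unfolding M_def Q(2) by (auto simp: K_def)
      finally show ?thesis .
    qed
    then show ?thesis by auto
  qed
  show ?thesis
    unfolding Phi
  proof (intro conjI)
    show "maximal_monotone_op_of_type l\<^sub>0 (A_Theta A\<^sub>0 \<tau> l\<^sub>0 (subdifferential \<phi>))"
      using single_valued_M monotone_M M_plus_one_surj
      by (intro maximal_monotone_op_of_type_shiftI) (simp_all add: shift)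
    show "subpotential_maximal_monotone (op_shift (A_Theta A\<^sub>0 \<tau> l\<^sub>0 (subdifferential \<phi>)) l\<^sub>0)"
      unfolding subpotential_maximal_monotone_def shift
      using proper_convex_Phi M_eq_subdifferential maximal_monotone_M by blast
  qed (simp_all add: proper_convex_Phi shift M_eq_subdifferential)
qed

end
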